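(* Let $k$ be a field of characteristic different from $2$ containing a primitive fourth root of unity $i$. Let $X,Y$ be the algebra generators of the quantum double $D(H(2))$, and let $x,y$ be the generators of the quasi-Hopf algebra $H(2)\otimes H(2)\cong k[C_2\times C_2]$. Let $\omega_\pm=1\pm i$ and consider the elements $$\mathbf U_\pm=p_+\otimes1+p_-\otimes g+\omega_\mp\,p_-\otimes p_-,$$ $$\mathbf F_\pm=1-2p^x_-p^y_-\otimes p^x_-p^y_+-2p^x_+p^y_-\otimes p^x_-p^y_--\omega_\pm\,p^x_-\otimes p^y_-,$$ where $p^x_\pm=\frac12(1\pm x)$ and $p^y_\pm=\frac12(1\pm y)$. Then the maps $\zeta_\pm:D(H(2))\to(H(2)\otimes H(2))^{\mathbf U_\pm}_{\mathbf F_\pm}$ given by $$\zeta_\pm(X)=xy,\qquad \zeta_\pm(Y)=-1+\omega_\pm p^x_-+\omega_\mp p^y_-=-\tfrac12(\omega_\pm x+\omega_\mp y)$$ are quasi-Hopf algebra isomorphisms.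
   Context: All algebras and linear spaces are over the field $k$; $\otimes=\otimes_k$. A quasi-bialgebra is a tuple $(H,\Delta,\varepsilon,\Phi)$ where $H$ is an associative unital algebra, $\Phi\in H\otimes H\otimes H$ (the reassociator) is invertible, and $\Delta:H\to H\otimes H$, $\varepsilon:H\to k$ are algebra homomorphisms such that, for all $h\in H$: $(\mathrm{id}\otimes\Delta)(\Delta(h))=\Phi(\Delta\otimes \mathrm{id})(\Delta(h))\Phi^{-1}$; $(\mathrm{id}\otimes\varepsilon)(\Delta(h))=h=(\varepsilon\otimes \mathrm{id})(\Delta(h))$; $(1\otimes\Phi)(\mathrm{id}\otimes\Delta\otimes \mathrm{id})(\Phi)(\Phi\otimes 1)=(\mathrm{id}\otimes \mathrm{id}\otimes\Delta)(\Phi)(\Delta\otimes \mathrm{id}\otimes \mathrm{id})(\Phi)$; $(\mathrm{id}\otimes\varepsilon\otimes \mathrm{id})(\Phi)=1\otimes 1$. With $\Delta(h)=h_1\otimes h_2$, $\Phi=X^1\otimes X^2\otimes X^3$, $\Phi^{-1}=x^1\otimes x^2\otimes x^3$ (summation understood; superscripts label tensor components), $H$ is a quasi-Hopf algebra if moreover there are an algebra anti-morphism $S:H\to H$ and $\alpha,\beta\in H$ with $S(h_1)\alpha h_2=\varepsilon(h)\alpha$, $h_1\beta S(h_2)=\varepsilon(h)\beta$, $X^1\beta S(X^2)\alpha X^3=1$, $S(x^1)\alpha x^2\beta S(x^3)=1$. A quasi-Hopf algebra isomorphism is an algebra isomorphism compatible with comultiplication, counit, reassociator, antipode and the elements $\alpha,\beta$.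 Twisting: a gauge transformation (twist) is an invertible $F=F^1\otimes F^2\in H\otimes H$ with $(\varepsilon\otimes\mathrm{id})(F)=(\mathrm{id}\otimes\varepsilon)(F)=1$; writing $F^{-1}=G^1\otimes G^2$, $H_F$ is the quasi-Hopf algebra with the same algebra, counit and antipode and $\Delta_F(h)=F\Delta(h)F^{-1}$, $\Phi_F=(1\otimes F)(\mathrm{id}\otimes\Delta)(F)\Phi(\Delta\otimes\mathrm{id})(F^{-1})(F^{-1}\otimes1)$, $\alpha_F=S(G^1)\alpha G^2$, $\beta_F=F^1\beta S(F^2)$. For an invertible element $\mathbb U\in H$, $H^{\mathbb U}$ is the quasi-Hopf algebra $(H,\Delta,\varepsilon,\Phi)$ with antipode $S_{\mathbb U}(h)=\mathbb US(h)\mathbb U^{-1}$, $\alpha_{\mathbb U}=\mathbb U\alpha$, $\beta_{\mathbb U}=\beta\mathbb U^{-1}$. $H_F^{\mathbb U}$ means $(H_F)^{\mathbb U}$. $H(2)$: the bialgebra $k[C_2]$, $C_2=\langle g\rangle$ of order two, with reassociator $\Phi=1-2p_-\otimes p_-\otimes p_-$, $p_\pm=\frac12(1\pm g)$, antipode $S=\mathrm{id}$, $\alpha=g$, $\beta=1$. $H(2)\otimes H(2)$ has the componentwise (tensor product) quasi-Hopf structure. With $x=1\otimes g$, $y=g\otimes1$ it is $k[C_2\times C_2]$ as a bialgebra, with reassociator $\Phi_{x,y}=(1-2p^x_-\otimes p^x_-\otimes p^x_-)(1-2p^y_-\otimes p^y_-\otimes p^y_-)$, $\alpha=xy$, $\beta=1$,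 and antipode the identity. The element $\mathbf U_\pm$ is an element of $H(2)\otimes H(2)$ and $\mathbf F_\pm$ is an element of $(H(2)\otimes H(2))\otimes(H(2)\otimes H(2))$. The quantum double $D(H(2))$ is (as a quasi-Hopf algebra) the commutative unital algebra generated by $X,Y$ with relations $X^2=1$, $Y^2=X$, $XY=YX$, with $\Delta(X)=X\otimes X$, $\varepsilon(X)=1$, $\Delta(Y)=-\frac12(Y\otimes Y+XY\otimes Y+Y\otimes XY-XY\otimes XY)$, $\varepsilon(Y)=-1$, reassociator $1-2p^X_-\otimes p^X_-\otimes p^X_-$ with $p^X_-=\frac12(1-X)$, $\alpha=X$, $\beta=1$, and antipode the identity. *)

theory Defs
  imports
    Complex_Main
    "HOL-Library.Poly_Mapping"
    "HOL-Library.Product_Plus"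
    "HOL-Library.Numeral_Type"
    "HOL-Library.Z2"
begin

section \<open>Vector spaces with a basis and their tensor products\<close>

text \<open>
  Every vector space has a basis, so a vector space over the field \<open>'k\<close> is represented as the
  space \<open>'a \<Rightarrow>\<^sub>0 'k\<close> of finitely supported coefficient functions on a basis \<open>'a\<close>
  (of any cardinality).  The tensor product of \<open>'a \<Rightarrow>\<^sub>0 'k\<close> and \<open>'b \<Rightarrow>\<^sub>0 'k\<close> is then
  \<open>'a \<times> 'b \<Rightarrow>\<^sub>0 'k\<close>.  The ring multiplication that the library puts on
  \<open>'a \<Rightarrow>\<^sub>0 'k\<close> for a monoid \<open>'a\<close> is used below only where a monoid algebra is meant;
  algebra multiplications are explicit otherwise.
\<close>

abbreviation bas :: "'a \<Rightarrow> ('a \<Rightarrow>\<^sub>0 'k::field)"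
  where "bas a \<equiv> Poly_Mapping.single a 1"

definition scale :: "'k::field \<Rightarrow> ('a \<Rightarrow>\<^sub>0 'k) \<Rightarrow> ('a \<Rightarrow>\<^sub>0 'k)"
  where "scale c v = Poly_Mapping.map ((*) c) v"

lemma lookup_scale [simp]: "poly_mapping.lookup (scale c v) a = c * poly_mapping.lookup v a"
  unfolding scale_def by (simp add: Poly_Mapping.map.rep_eq when_def)

lemma vector_space_scale: "vector_space (scale :: 'k::field \<Rightarrow> ('a \<Rightarrow>\<^sub>0 'k) \<Rightarrow> _)"
  by unfold_locales (auto intro!: poly_mapping_eqI simp: lookup_add algebra_simps)

abbreviation lin :: "(('a \<Rightarrow>\<^sub>0 'k::field) \<Rightarrow> ('b \<Rightarrow>\<^sub>0 'k)) \<Rightarrow> bool"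
  where "lin \<equiv> Vector_Spaces.linear scale scale"

text \<open>Linear extension of a map given on the basis, with values in a vector space or in \<open>'k\<close>.\<close>

definition lin_ext :: "('a \<Rightarrow> ('b \<Rightarrow>\<^sub>0 'k::field)) \<Rightarrow> ('a \<Rightarrow>\<^sub>0 'k) \<Rightarrow> ('b \<Rightarrow>\<^sub>0 'k)"
  where "lin_ext f v = (\<Sum>a\<in>Poly_Mapping.keys v. scale (poly_mapping.lookup v a) (f a))"

definition lin_form :: "('a \<Rightarrow> 'k::field) \<Rightarrow> ('a \<Rightarrow>\<^sub>0 'k) \<Rightarrow> 'k"
  where "lin_form f v = (\<Sum>a\<in>Poly_Mapping.keys v. poly_mapping.lookup v a * f a)"

definition tens :: "('a \<Rightarrow>\<^sub>0 'k::field) \<Rightarrow> ('b \<Rightarrow>\<^sub>0 'k) \<Rightarrow> ('a \<times> 'b \<Rightarrow>\<^sub>0 'k)"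
    (infixr \<open>\<otimes>\<close> 75)
  where "u \<otimes> v = lin_ext (\<lambda>a. lin_ext (\<lambda>b. bas (a, b)) v) u"

definition tmap :: "(('a \<Rightarrow>\<^sub>0 'k::field) \<Rightarrow> ('c \<Rightarrow>\<^sub>0 'k)) \<Rightarrow> (('b \<Rightarrow>\<^sub>0 'k) \<Rightarrow> ('d \<Rightarrow>\<^sub>0 'k))
    \<Rightarrow> ('a \<times> 'b \<Rightarrow>\<^sub>0 'k) \<Rightarrow> ('c \<times> 'd \<Rightarrow>\<^sub>0 'k)"
  where "tmap f g = lin_ext (\<lambda>(a, b). f (bas a) \<otimes> g (bas b))"

definition relabel :: "('a \<Rightarrow> 'b) \<Rightarrow> ('a \<Rightarrow>\<^sub>0 'k::field) \<Rightarrow> ('b \<Rightarrow>\<^sub>0 'k)"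
  where "relabel f = lin_ext (\<lambda>a. bas (f a))"

text \<open>Iterated tensor products are nested to the right; \<open>assoc\<close> and \<open>assoc3\<close> are the
  canonical identifications \<open>(A \<otimes> B) \<otimes> C \<cong> A \<otimes> B \<otimes> C\<close> and
  \<open>(A \<otimes> B \<otimes> C) \<otimes> D \<cong> A \<otimes> B \<otimes> C \<otimes> D\<close>.\<close>

definition assoc :: "(('a \<times> 'b) \<times> 'c \<Rightarrow>\<^sub>0 'k::field) \<Rightarrow> ('a \<times> 'b \<times> 'c \<Rightarrow>\<^sub>0 'k)"
  where "assoc = relabel (\<lambda>((a, b), c). (a, b, c))"

definition assoc3 :: "(('a \<times> 'b \<times> 'c) \<times> 'd \<Rightarrow>\<^sub>0 'k::field) \<Rightarrow> ('a \<times> 'b \<times> 'c \<times> 'd \<Rightarrow>\<^sub>0 'k)"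
  where "assoc3 = relabel (\<lambda>((a, b, c), d). (a, b, c, d))"


section \<open>Algebras\<close>

record (overloaded) ('a, 'k::field) alg =
  mul :: "('a \<Rightarrow>\<^sub>0 'k) \<Rightarrow> ('a \<Rightarrow>\<^sub>0 'k) \<Rightarrow> ('a \<Rightarrow>\<^sub>0 'k)"
  unt :: "'a \<Rightarrow>\<^sub>0 'k"

abbreviation mul_in :: "('a \<Rightarrow>\<^sub>0 'k::field) \<Rightarrow> ('a, 'k, 'm) alg_scheme \<Rightarrow> ('a \<Rightarrow>\<^sub>0 'k) \<Rightarrow> ('a \<Rightarrow>\<^sub>0 'k)"
    (\<open>(_ \<cdot>\<^bsub>_\<^esub>/ _)\<close> [70, 0, 71] 70)
  where "u \<cdot>\<^bsub>A\<^esub> v \<equiv> mul A u v"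

definition is_alg :: "('a, 'k::field, 'm) alg_scheme \<Rightarrow> bool" where
  "is_alg A \<longleftrightarrow>
     (\<forall>u. lin (\<lambda>v. u \<cdot>\<^bsub>A\<^esub> v)) \<and> (\<forall>v. lin (\<lambda>u. u \<cdot>\<^bsub>A\<^esub> v)) \<and>
     (\<forall>u v w. u \<cdot>\<^bsub>A\<^esub> v \<cdot>\<^bsub>A\<^esub> w = u \<cdot>\<^bsub>A\<^esub> (v \<cdot>\<^bsub>A\<^esub> w)) \<and>
     (\<forall>u. unt A \<cdot>\<^bsub>A\<^esub> u = u \<and> u \<cdot>\<^bsub>A\<^esub> unt A = u)"

definition alg_invertible :: "('a, 'k::field, 'm) alg_scheme \<Rightarrow> ('a \<Rightarrow>\<^sub>0 'k) \<Rightarrow> bool" where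
  "alg_invertible A u \<longleftrightarrow> (\<exists>v. u \<cdot>\<^bsub>A\<^esub> v = unt A \<and> v \<cdot>\<^bsub>A\<^esub> u = unt A)"

definition alg_inv :: "('a, 'k::field, 'm) alg_scheme \<Rightarrow> ('a \<Rightarrow>\<^sub>0 'k) \<Rightarrow> ('a \<Rightarrow>\<^sub>0 'k)" where
  "alg_inv A u = (THE v. u \<cdot>\<^bsub>A\<^esub> v = unt A \<and> v \<cdot>\<^bsub>A\<^esub> u = unt A)"

definition alg_power :: "('a, 'k::field, 'm) alg_scheme \<Rightarrow> ('a \<Rightarrow>\<^sub>0 'k) \<Rightarrow> nat \<Rightarrow> ('a \<Rightarrow>\<^sub>0 'k)" where
  "alg_power A u n = ((\<lambda>v. u \<cdot>\<^bsub>A\<^esub> v) ^^ n) (unt A)"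

definition tensor_alg :: "('a, 'k::field, 'm) alg_scheme \<Rightarrow> ('b, 'k, 'n) alg_scheme \<Rightarrow> ('a \<times> 'b, 'k) alg" where
  "tensor_alg A B = \<lparr>
     mul = (\<lambda>s t. lin_ext (\<lambda>(a, b). lin_ext (\<lambda>(c, d).
              (bas a \<cdot>\<^bsub>A\<^esub> bas c) \<otimes> (bas b \<cdot>\<^bsub>B\<^esub> bas d)) t) s),
     unt = unt A \<otimes> unt B\<rparr>"

definition alg_hom :: "('a, 'k::field, 'm) alg_scheme \<Rightarrow> ('b, 'k, 'n) alg_scheme
    \<Rightarrow> (('a \<Rightarrow>\<^sub>0 'k) \<Rightarrow> ('b \<Rightarrow>\<^sub>0 'k)) \<Rightarrow> bool" where
  "alg_hom A B f \<longleftrightarrow>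
     lin f \<and> (\<forall>u v. f (u \<cdot>\<^bsub>A\<^esub> v) = f u \<cdot>\<^bsub>B\<^esub> f v) \<and> f (unt A) = unt B"

definition alg_antihom :: "('a, 'k::field, 'm) alg_scheme \<Rightarrow> ('b, 'k, 'n) alg_scheme
    \<Rightarrow> (('a \<Rightarrow>\<^sub>0 'k) \<Rightarrow> ('b \<Rightarrow>\<^sub>0 'k)) \<Rightarrow> bool" where
  "alg_antihom A B f \<longleftrightarrow>
     lin f \<and> (\<forall>u v. f (u \<cdot>\<^bsub>A\<^esub> v) = f v \<cdot>\<^bsub>B\<^esub> f u) \<and> f (unt A) = unt B"

text \<open>Algebra homomorphisms to the ground field.\<close>

definition alg_char :: "('a, 'k::field, 'm) alg_scheme \<Rightarrow> (('a \<Rightarrow>\<^sub>0 'k) \<Rightarrow> 'k) \<Rightarrow> bool" where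
  "alg_char A f \<longleftrightarrow>
     Vector_Spaces.linear scale (*) f \<and> (\<forall>u v. f (u \<cdot>\<^bsub>A\<^esub> v) = f u * f v) \<and> f (unt A) = 1"


section \<open>Quasi-Hopf algebras\<close>

record (overloaded) ('a, 'k::field) qha = "('a, 'k) alg" +
  comult :: "('a \<Rightarrow>\<^sub>0 'k) \<Rightarrow> ('a \<times> 'a \<Rightarrow>\<^sub>0 'k)"
  counit :: "('a \<Rightarrow>\<^sub>0 'k) \<Rightarrow> 'k"
  reassoc :: "'a \<times> 'a \<times> 'a \<Rightarrow>\<^sub>0 'k"
  antip :: "('a \<Rightarrow>\<^sub>0 'k) \<Rightarrow> ('a \<Rightarrow>\<^sub>0 'k)"
  alph :: "'a \<Rightarrow>\<^sub>0 'k"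
  bet :: "'a \<Rightarrow>\<^sub>0 'k"

abbreviation alg2 :: "('a, 'k::field, 'm) alg_scheme \<Rightarrow> ('a \<times> 'a, 'k) alg"
  where "alg2 A \<equiv> tensor_alg A A"

abbreviation alg3 :: "('a, 'k::field, 'm) alg_scheme \<Rightarrow> ('a \<times> 'a \<times> 'a, 'k) alg"
  where "alg3 A \<equiv> tensor_alg A (alg2 A)"

abbreviation alg4 :: "('a, 'k::field, 'm) alg_scheme \<Rightarrow> ('a \<times> 'a \<times> 'a \<times> 'a, 'k) alg"
  where "alg4 A \<equiv> tensor_alg A (alg3 A)"

text \<open>\<open>id \<otimes> \<epsilon>\<close> and \<open>\<epsilon> \<otimes> id\<close>, with \<open>V \<otimes> k\<close> and \<open>k \<otimes> V\<close> identified with \<open>V\<close>.\<close>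

definition contract_right :: "(('b \<Rightarrow>\<^sub>0 'k::field) \<Rightarrow> 'k) \<Rightarrow> ('a \<times> 'b \<Rightarrow>\<^sub>0 'k) \<Rightarrow> ('a \<Rightarrow>\<^sub>0 'k)"
  where "contract_right e = lin_ext (\<lambda>(a, b). scale (e (bas b)) (bas a))"

definition contract_left :: "(('a \<Rightarrow>\<^sub>0 'k::field) \<Rightarrow> 'k) \<Rightarrow> ('a \<times> 'b \<Rightarrow>\<^sub>0 'k) \<Rightarrow> ('b \<Rightarrow>\<^sub>0 'k)"
  where "contract_left e = lin_ext (\<lambda>(a, b). scale (e (bas a)) (bas b))"

definition quasi_bialgebra :: "('a, 'k::field) qha \<Rightarrow> bool" where
  "quasi_bialgebra H \<longleftrightarrow>
     is_alg H \<and>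
     alg_hom H (alg2 H) (comult H) \<and>
     alg_char H (counit H) \<and>
     alg_invertible (alg3 H) (reassoc H) \<and>
     (\<forall>h. tmap id (comult H) (comult H h) =
        reassoc H \<cdot>\<^bsub>alg3 H\<^esub> assoc (tmap (comult H) id (comult H h))
          \<cdot>\<^bsub>alg3 H\<^esub> alg_inv (alg3 H) (reassoc H)) \<and>
     (\<forall>h. contract_right (counit H) (comult H h) = h) \<and>
     (\<forall>h. contract_left (counit H) (comult H h) = h) \<and>
     (unt H \<otimes> reassoc H)
         \<cdot>\<^bsub>alg4 H\<^esub> tmap id (\<lambda>t. assoc (tmap (comult H) id t)) (reassoc H)
         \<cdot>\<^bsub>alg4 H\<^esub> assoc3 (reassoc H \<otimes> unt H)
       = tmap id (tmap id (comult H)) (reassoc H)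
         \<cdot>\<^bsub>alg4 H\<^esub> assoc (tmap (comult H) id (reassoc H)) \<and>
     tmap id (contract_left (counit H)) (reassoc H) = unt H \<otimes> unt H"

definition quasi_hopf :: "('a, 'k::field) qha \<Rightarrow> bool" where
  "quasi_hopf H \<longleftrightarrow>
     quasi_bialgebra H \<and>
     alg_antihom H H (antip H) \<and>
     (\<forall>h. lin_ext (\<lambda>(a, b). antip H (bas a) \<cdot>\<^bsub>H\<^esub> alph H \<cdot>\<^bsub>H\<^esub> bas b) (comult H h)
          = scale (counit H h) (alph H)) \<and>
     (\<forall>h. lin_ext (\<lambda>(a, b). bas a \<cdot>\<^bsub>H\<^esub> bet H \<cdot>\<^bsub>H\<^esub> antip H (bas b)) (comult H h)
          = scale (counit H h) (bet H)) \<and>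
     lin_ext (\<lambda>(a, b, c). bas a \<cdot>\<^bsub>H\<^esub> bet H \<cdot>\<^bsub>H\<^esub> antip H (bas b) \<cdot>\<^bsub>H\<^esub> alph H \<cdot>\<^bsub>H\<^esub> bas c)
       (reassoc H) = unt H \<and>
     lin_ext (\<lambda>(a, b, c). antip H (bas a) \<cdot>\<^bsub>H\<^esub> alph H \<cdot>\<^bsub>H\<^esub> bas b \<cdot>\<^bsub>H\<^esub> bet H \<cdot>\<^bsub>H\<^esub> antip H (bas c))
       (alg_inv (alg3 H) (reassoc H)) = unt H"

definition quasi_hopf_iso :: "('a, 'k::field) qha \<Rightarrow> ('b, 'k) qha
    \<Rightarrow> (('a \<Rightarrow>\<^sub>0 'k) \<Rightarrow> ('b \<Rightarrow>\<^sub>0 'k)) \<Rightarrow> bool" where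
  "quasi_hopf_iso H K f \<longleftrightarrow>
     quasi_hopf H \<and> quasi_hopf K \<and> alg_hom H K f \<and> bij f \<and>
     (\<forall>h. comult K (f h) = tmap f f (comult H h)) \<and>
     (\<forall>h. counit K (f h) = counit H h) \<and>
     reassoc K = tmap f (tmap f f) (reassoc H) \<and>
     (\<forall>h. antip K (f h) = f (antip H h)) \<and>
     alph K = f (alph H) \<and>
     bet K = f (bet H)"

definition tensor_qha :: "('a, 'k::field) qha \<Rightarrow> ('b, 'k) qha \<Rightarrow> ('a \<times> 'b, 'k) qha" where
  "tensor_qha H K = \<lparr>
     mul = mul (tensor_alg H K),
     unt = unt (tensor_alg H K),
     comult = (\<lambda>t. relabel (\<lambda>((a, a'), (b, b')). ((a, b), (a', b'))) (tmap (comult H) (comult K) t)),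
     counit = lin_form (\<lambda>(a, b). counit H (bas a) * counit K (bas b)),
     reassoc = relabel (\<lambda>((a, a', a''), (b, b', b'')). ((a, b), (a', b'), (a'', b'')))
                 (reassoc H \<otimes> reassoc K),
     antip = tmap (antip H) (antip K),
     alph = alph H \<otimes> alph K,
     bet = bet H \<otimes> bet K\<rparr>"

definition is_twist :: "('a, 'k::field) qha \<Rightarrow> ('a \<times> 'a \<Rightarrow>\<^sub>0 'k) \<Rightarrow> bool" where
  "is_twist H F \<longleftrightarrow> alg_invertible (alg2 H) F \<and>
     contract_left (counit H) F = unt H \<and> contract_right (counit H) F = unt H"

definition twist :: "('a, 'k::field) qha \<Rightarrow> ('a \<times> 'a \<Rightarrow>\<^sub>0 'k) \<Rightarrow> ('a, 'k) qha" where
  "twist H F = (let G = alg_inv (alg2 H) F in H\<lparr>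
     comult := (\<lambda>h. F \<cdot>\<^bsub>alg2 H\<^esub> comult H h \<cdot>\<^bsub>alg2 H\<^esub> G),
     reassoc := (unt H \<otimes> F) \<cdot>\<^bsub>alg3 H\<^esub> tmap id (comult H) F \<cdot>\<^bsub>alg3 H\<^esub> reassoc H
       \<cdot>\<^bsub>alg3 H\<^esub> assoc (tmap (comult H) id G) \<cdot>\<^bsub>alg3 H\<^esub> assoc (G \<otimes> unt H),
     alph := lin_ext (\<lambda>(a, b). antip H (bas a) \<cdot>\<^bsub>H\<^esub> alph H \<cdot>\<^bsub>H\<^esub> bas b) G,
     bet := lin_ext (\<lambda>(a, b). bas a \<cdot>\<^bsub>H\<^esub> bet H \<cdot>\<^bsub>H\<^esub> antip H (bas b)) F\<rparr>)"

definition change_antip :: "('a, 'k::field) qha \<Rightarrow> ('a \<Rightarrow>\<^sub>0 'k) \<Rightarrow> ('a, 'k) qha" where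
  "change_antip H U = H\<lparr>
     antip := (\<lambda>h. U \<cdot>\<^bsub>H\<^esub> antip H h \<cdot>\<^bsub>H\<^esub> alg_inv H U),
     alph := U \<cdot>\<^bsub>H\<^esub> alph H,
     bet := bet H \<cdot>\<^bsub>H\<^esub> alg_inv H U\<rparr>"


section \<open>The quasi-Hopf algebra \<open>H(2)\<close> and its tensor square\<close>

definition p_plus :: "('a, 'k::field, 'm) alg_scheme \<Rightarrow> ('a \<Rightarrow>\<^sub>0 'k) \<Rightarrow> ('a \<Rightarrow>\<^sub>0 'k)"
  where "p_plus A u = scale (1/2) (unt A + u)"

definition p_minus :: "('a, 'k::field, 'm) alg_scheme \<Rightarrow> ('a \<Rightarrow>\<^sub>0 'k) \<Rightarrow> ('a \<Rightarrow>\<^sub>0 'k)"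
  where "p_minus A u = scale (1/2) (unt A - u)"

text \<open>The group \<open>C\<^sub>2\<close> is the additive group of \<^typ>\<open>bit\<close>; thus the library's convolution product on
  \<open>bit \<Rightarrow>\<^sub>0 'k\<close> is that of the group algebra.\<close>

definition kC2 :: "(bit, 'k::field) alg"
  where "kC2 = \<lparr>mul = (*), unt = 1\<rparr>"

definition gen_g :: "bit \<Rightarrow>\<^sub>0 'k::field"
  where "gen_g = bas 1"

definition H2 :: "(bit, 'k::field) qha" where
  "H2 = \<lparr>
     mul = mul kC2,
     unt = unt kC2,
     comult = lin_ext (\<lambda>a. bas (a, a)),
     counit = lin_form (\<lambda>a. 1),
     reassoc = unt (alg3 kC2)
       - scale 2 (p_minus kC2 gen_g \<otimes> p_minus kC2 gen_g \<otimes> p_minus kC2 gen_g),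
     antip = id,
     alph = gen_g,
     bet = unt kC2\<rparr>"

definition H22 :: "(bit \<times> bit, 'k::field) qha"
  where "H22 = tensor_qha H2 H2"

definition gen_x :: "bit \<times> bit \<Rightarrow>\<^sub>0 'k::field"
  where "gen_x = unt H2 \<otimes> gen_g"

definition gen_y :: "bit \<times> bit \<Rightarrow>\<^sub>0 'k::field"
  where "gen_y = gen_g \<otimes> unt H2"

text \<open>In the following two definitions \<open>w\<close> stands for \<open>\<omega>\<^sub>\<plusminus>\<close> and \<open>w'\<close> for \<open>\<omega>\<^sub>\<mp>\<close>.\<close>

definition U_elt :: "'k::field \<Rightarrow> (bit \<times> bit \<Rightarrow>\<^sub>0 'k)" where
  "U_elt w' = (let pp = p_plus H2 gen_g; pm = p_minus H2 gen_g in
     pp \<otimes> unt H2 + pm \<otimes> gen_g + scale w' (pm \<otimes> pm))"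

definition F_elt :: "'k::field \<Rightarrow> ((bit \<times> bit) \<times> (bit \<times> bit) \<Rightarrow>\<^sub>0 'k)" where
  "F_elt w = (let xp = p_plus H22 gen_x; xm = p_minus H22 gen_x;
                  yp = p_plus H22 gen_y; ym = p_minus H22 gen_y in
     unt (alg2 H22)
     - scale 2 ((xm \<cdot>\<^bsub>H22\<^esub> ym) \<otimes> (xm \<cdot>\<^bsub>H22\<^esub> yp))
     - scale 2 ((xp \<cdot>\<^bsub>H22\<^esub> ym) \<otimes> (xm \<cdot>\<^bsub>H22\<^esub> ym))
     - scale w (xm \<otimes> ym))"


section \<open>The quantum double of \<open>H(2)\<close>\<close>

text \<open>The polynomial algebra in two commuting variables \<open>S, T\<close> is the monoid algebra
  \<open>nat \<times> nat \<Rightarrow>\<^sub>0 'k\<close>: the basis element \<open>(m, n)\<close> is the monomial \<open>S^m T^n\<close>.\<close>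

definition eval2 :: "('b, 'k::field, 'm) alg_scheme \<Rightarrow> ('b \<Rightarrow>\<^sub>0 'k) \<Rightarrow> ('b \<Rightarrow>\<^sub>0 'k)
    \<Rightarrow> (nat \<times> nat \<Rightarrow>\<^sub>0 'k) \<Rightarrow> ('b \<Rightarrow>\<^sub>0 'k)" where
  "eval2 A X Y = lin_ext (\<lambda>(m, n). alg_power A X m \<cdot>\<^bsub>A\<^esub> alg_power A Y n)"

text \<open>\<open>A\<close> is the commutative algebra presented by generators \<open>X, Y\<close> and relations
  \<open>X\<^sup>2 = 1\<close>, \<open>Y\<^sup>2 = X\<close>: evaluation at \<open>(X, Y)\<close> maps the polynomial algebra onto \<open>A\<close>, and its kernel
  is the ideal generated by \<open>S\<^sup>2 - 1\<close> and \<open>T\<^sup>2 - S\<close>.\<close>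

definition DH2_presented :: "('b, 'k::field, 'm) alg_scheme \<Rightarrow> ('b \<Rightarrow>\<^sub>0 'k) \<Rightarrow> ('b \<Rightarrow>\<^sub>0 'k) \<Rightarrow> bool" where
  "DH2_presented A X Y \<longleftrightarrow>
     is_alg A \<and> (\<forall>u v. u \<cdot>\<^bsub>A\<^esub> v = v \<cdot>\<^bsub>A\<^esub> u) \<and>
     surj (eval2 A X Y) \<and>
     (\<forall>p. eval2 A X Y p = 0 \<longleftrightarrow>
       (\<exists>q r. p = q * (bas (2, 0) - 1) + r * (bas (0, 2) - bas (1, 0))))"

text \<open>\<open>D\<close> is the quantum double \<open>D(H(2))\<close> with generators \<open>X, Y\<close>.  Since \<open>X, Y\<close> generate \<open>D\<close>, the
  values of the algebra homomorphisms \<open>comult D\<close> and \<open>counit D\<close> on \<open>X, Y\<close> determine them.  The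
  axioms of a quasi-Hopf algebra are not part of this description.\<close>

definition is_DH2 :: "('b, 'k::field) qha \<Rightarrow> ('b \<Rightarrow>\<^sub>0 'k) \<Rightarrow> ('b \<Rightarrow>\<^sub>0 'k) \<Rightarrow> bool" where
  "is_DH2 D X Y \<longleftrightarrow> (let XY = X \<cdot>\<^bsub>D\<^esub> Y; pm = p_minus D X in
     DH2_presented D X Y \<and>
     alg_hom D (alg2 D) (comult D) \<and>
     comult D X = X \<otimes> X \<and>
     comult D Y = scale (- (1/2)) (Y \<otimes> Y + XY \<otimes> Y + Y \<otimes> XY - XY \<otimes> XY) \<and>
     alg_char D (counit D) \<and>
     counit D X = 1 \<and> counit D Y = -1 \<and>
     reassoc D = unt (alg3 D) - scale 2 (pm \<otimes> pm \<otimes> pm) \<and>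
     antip D = id \<and>
     alph D = X \<and>
     bet D = unt D)"


section \<open>The description of the quantum double is satisfiable\<close>

text \<open>The algebra of \<open>D(H(2))\<close> is isomorphic to the group algebra of the cyclic group of order four
  with generator \<open>Y\<close>, which gives a model on the basis \<^typ>\<open>4\<close>.\<close>

lemma lin_iff:
  fixes f :: "('a \<Rightarrow>\<^sub>0 'k::field) \<Rightarrow> ('b \<Rightarrow>\<^sub>0 'k)"
  shows "lin f \<longleftrightarrow> (\<forall>u v. f (u + v) = f u + f v) \<and> (\<forall>c u. f (scale c u) = scale c (f u))"
  using vector_space_scale[where 'a = 'a and 'k = 'k] vector_space_scale[where 'a = 'b and 'k = 'k]
  unfolding Vector_Spaces.linear_iff_module_hom module_hom_iff
  by (auto simp: vector_space_def module_def)

lemma lin_form_iff: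
  fixes f :: "('a \<Rightarrow>\<^sub>0 'k::field) \<Rightarrow> 'k"
  shows "Vector_Spaces.linear scale (*) f \<longleftrightarrow>
     (\<forall>u v. f (u + v) = f u + f v) \<and> (\<forall>c u. f (scale c u) = c * f u)"
proof -
  have "module ((*) :: 'k \<Rightarrow> _)" by unfold_locales (auto simp: algebra_simps)
  then show ?thesis
    using vector_space_scale[where 'a = 'a and 'k = 'k] unfolding Vector_Spaces.linear_iff_module_hom module_hom_iff
    by (auto simp: vector_space_def module_def)
qed

lemma scale_eq_mult: "scale c v = Poly_Mapping.single 0 c * v"
  for v :: "'a::monoid_add \<Rightarrow>\<^sub>0 'k::field"
  unfolding scale_def by (rule mult_map_scale_conv_mult)

lemma expand_bas: "v = (\<Sum>a\<in>Poly_Mapping.keys v. scale (poly_mapping.lookup v a) (bas a))"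
  by (rule poly_mapping_eqI)
    (auto simp: lookup_sum lookup_single when_def in_keys_iff if_distrib sum.delta cong: if_cong)

lemma bas_induct [case_names zero add scale bas]:
  assumes "P 0" "\<And>u v. P u \<Longrightarrow> P v \<Longrightarrow> P (u + v)" "\<And>c u. P u \<Longrightarrow> P (scale c u)" "\<And>a. P (bas a)"
  shows "P v"
proof -
  have "P (\<Sum>a\<in>A. scale (poly_mapping.lookup v a) (bas a))" if "finite A" for A
    using that by (induction A) (auto intro: assms)
  then show ?thesis by (subst expand_bas) simp
qed

lemma lin_ext_eq:
  assumes "finite A" "Poly_Mapping.keys v \<subseteq> A"
  shows "lin_ext f v = (\<Sum>a\<in>A. scale (poly_mapping.lookup v a) (f a))"
  unfolding lin_ext_def using assms
  by (intro sum.mono_neutral_left) (auto simp: in_keys_iff intro!: poly_mapping_eqI)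

lemma lin_form_eq:
  assumes "finite A" "Poly_Mapping.keys v \<subseteq> A"
  shows "lin_form f v = (\<Sum>a\<in>A. poly_mapping.lookup v a * f a)"
  unfolding lin_form_def using assms
  by (intro sum.mono_neutral_left) (auto simp: in_keys_iff)

lemma lin_lin_ext: "lin (lin_ext f)" for f :: "'a \<Rightarrow> ('b \<Rightarrow>\<^sub>0 'k::field)"
  unfolding lin_iff
proof (intro conjI allI)
  fix u v :: "'a \<Rightarrow>\<^sub>0 'k"
  let ?A = "Poly_Mapping.keys u \<union> Poly_Mapping.keys v"
  have "lin_ext f w = (\<Sum>a\<in>?A. scale (poly_mapping.lookup w a) (f a))"
    if "w \<in> {u, v, u + v}" for w
    using that keys_add[of u v] by (intro lin_ext_eq) auto
  then show "lin_ext f (u + v) = lin_ext f u + lin_ext f v"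
    by (auto simp: lookup_add lookup_sum sum.distrib[symmetric] algebra_simps intro!: poly_mapping_eqI)
next
  fix c and u :: "'a \<Rightarrow>\<^sub>0 'k"
  have "lin_ext f w = (\<Sum>a\<in>Poly_Mapping.keys u. scale (poly_mapping.lookup w a) (f a))"
    if "w \<in> {u, scale c u}" for w
    using that by (intro lin_ext_eq) (auto simp: in_keys_iff)
  then show "lin_ext f (scale c u) = scale c (lin_ext f u)"
    by (auto simp: lookup_sum sum_distrib_left mult.assoc intro!: poly_mapping_eqI)
qed

lemma lin_lin_form: "Vector_Spaces.linear scale (*) (lin_form f)" for f :: "'a \<Rightarrow> 'k::field"
  unfolding lin_form_iff
proof (intro conjI allI)
  fix u v :: "'a \<Rightarrow>\<^sub>0 'k"
  let ?A = "Poly_Mapping.keys u \<union> Poly_Mapping.keys v"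
  have "lin_form f w = (\<Sum>a\<in>?A. poly_mapping.lookup w a * f a)"
    if "w \<in> {u, v, u + v}" for w
    using that keys_add[of u v] by (intro lin_form_eq) auto
  then show "lin_form f (u + v) = lin_form f u + lin_form f v"
    by (auto simp: lookup_add sum.distrib[symmetric] algebra_simps)
next
  fix c and u :: "'a \<Rightarrow>\<^sub>0 'k"
  have "lin_form f w = (\<Sum>a\<in>Poly_Mapping.keys u. poly_mapping.lookup w a * f a)"
    if "w \<in> {u, scale c u}" for w
    using that by (intro lin_form_eq) (auto simp: in_keys_iff)
  then show "lin_form f (scale c u) = c * lin_form f u"
    by (auto simp: sum_distrib_left mult.assoc)
qed

lemma lin_ext_add: "lin_ext f (u + v) = lin_ext f u + lin_ext f v"
  and lin_ext_scale: "lin_ext f (scale c u) = scale c (lin_ext f u)"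
  using lin_lin_ext[of f] unfolding lin_iff by auto

lemma lin_form_add: "lin_form f (u + v) = lin_form f u + lin_form f v"
  and lin_form_scale: "lin_form f (scale c u) = c * lin_form f u"
  using lin_lin_form[of f] unfolding lin_form_iff by auto

lemma scale_1 [simp]: "scale 1 v = v"
  by (rule poly_mapping_eqI) simp

lemma scale_zero [simp]: "scale c 0 = 0"
  by (rule poly_mapping_eqI) simp

lemma scale_add: "scale c (u + v) = scale c u + scale c v"
  by (rule poly_mapping_eqI) (simp add: lookup_add algebra_simps)

lemma lin_ext_zero [simp]: "lin_ext f 0 = 0" by (simp add: lin_ext_def)
lemma lin_form_zero [simp]: "lin_form f 0 = 0" by (simp add: lin_form_def)
lemma lin_ext_bas [simp]: "lin_ext f (bas a) = f a" by (simp add: lin_ext_def)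
lemma lin_form_bas [simp]: "lin_form f (bas a) = f a" by (simp add: lin_form_def)

lemma bas_tens_bas [simp]: "bas a \<otimes> bas b = bas (a, b)"
  by (simp add: tens_def)

lemma scale_mult_left: "scale c u * v = scale c (u * v)"
  and scale_mult_right: "u * scale c v = scale c (u * v)"
  for u v :: "'a::comm_monoid_add \<Rightarrow>\<^sub>0 'k::field"
  by (simp_all add: scale_eq_mult ac_simps)

lemma bas_mult_bas: "bas a * bas b = bas (a + b)" for a :: "'a::monoid_add"
  by (simp add: mult_single)

lemma mult_eq_lin_ext:
  "s * t = lin_ext (\<lambda>a. lin_ext (\<lambda>b. bas (a + b)) t) s"
  for s t :: "'a::comm_monoid_add \<Rightarrow>\<^sub>0 'k::field"
proof (induction s rule: bas_induct)
  case (bas a)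
  show ?case
    by (induction t rule: bas_induct)
      (simp_all add: lin_ext_add lin_ext_scale bas_mult_bas distrib_left scale_mult_right)
qed (simp_all add: lin_ext_add lin_ext_scale distrib_right scale_mult_left)

lemma tensor_monoid_algebra:
  fixes A :: "('a::comm_monoid_add, 'k::field, 'm) alg_scheme"
    and B :: "('b::comm_monoid_add, 'k, 'n) alg_scheme"
  assumes "mul A = (*)" "unt A = 1" "mul B = (*)" "unt B = 1"
  shows "mul (tensor_alg A B) = (*)" "unt (tensor_alg A B) = 1"
proof -
  show "mul (tensor_alg A B) = (*)"
    using assms by (intro ext, subst mult_eq_lin_ext)
      (simp add: tensor_alg_def bas_mult_bas case_prod_unfold plus_prod_def)
  have "bas 0 \<otimes> bas 0 = (bas 0 :: 'a \<times> 'b \<Rightarrow>\<^sub>0 'k)"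
    by (simp add: zero_prod_def del: single_one)
  then show "unt (tensor_alg A B) = 1"
    using assms by (simp add: tensor_alg_def)
qed

lemma exhaust_type4: "r = 0 \<or> r = 1 \<or> r = 2 \<or> r = 3" for r :: 4
proof (cases r rule: bit0_cases)
  case (of_int z)
  then have "z = 0 \<or> z = 1 \<or> z = 2 \<or> z = 3" by auto
  then show ?thesis using of_int by auto
qed

definition expo :: "4 \<Rightarrow> nat"
  where "expo r = (if r = 0 then 0 else if r = 1 then 1 else if r = 2 then 2 else 3)"

lemma expo_add: "expo (r + s) = (expo r + expo s) mod 4"
  using exhaust_type4[of r] exhaust_type4[of s] by (auto simp: expo_def)

lemma power_expo_add: "u ^ expo (r + s) = u ^ expo r * u ^ expo s"
  if "u ^ 4 = 1" for u :: "'a::monoid_mult"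
proof -
  have "u ^ n = u ^ (n mod 4)" for n
  proof -
    have "u ^ n = u ^ (4 * (n div 4) + n mod 4)" by simp
    also have "\<dots> = u ^ (n mod 4)" using that by (simp only: power_add power_mult) simp
    finally show ?thesis .
  qed
  then show ?thesis by (metis expo_add power_add)
qed

definition DH2_comult_Y :: "4 \<times> 4 \<Rightarrow>\<^sub>0 'k::field"
  where "DH2_comult_Y = scale (- (1/2)) (bas (1, 1) + bas (3, 1) + bas (1, 3) - bas (3, 3))"

definition DH2_model :: "(4, 'k::field) qha" where
  "DH2_model = (let A = \<lparr>mul = (*), unt = 1\<rparr> :: (4, 'k) alg; pm = p_minus A (bas 2) in \<lparr>
     mul = (*),
     unt = 1,
     comult = lin_ext (\<lambda>r. DH2_comult_Y ^ expo r),
     counit = lin_form (\<lambda>r. (-1) ^ expo r),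
     reassoc = unt (alg3 A) - scale 2 (pm \<otimes> pm \<otimes> pm),
     antip = id,
     alph = bas 2,
     bet = 1\<rparr>)"

lemma four_zero: "(4::4) = 0" by simp

lemma square_aux:
  fixes P Q :: "'a::comm_ring_1"
  assumes "P * P = 1" "Q * Q = 1"
  shows "(1 + P + Q - P * Q) * (1 + P + Q - P * Q) = 4"
proof -
  have "(1 + P + Q - P * Q) * (1 + P + Q - P * Q) =
      1 + P * P + Q * Q + (P * P) * (Q * Q) + 2 * P + 2 * Q - 2 * (P * P) * Q - 2 * P * (Q * Q)"
    by (simp add: algebra_simps)
  then show ?thesis
    using assms by simp
qed

lemma DH2_comult_Y_square:
  assumes "(2::'k::field) \<noteq> 0"
  shows "DH2_comult_Y ^ 2 = (bas (2, 2) :: 4 \<times> 4 \<Rightarrow>\<^sub>0 'k)"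
proof -
  define a P Q h :: "4 \<times> 4 \<Rightarrow>\<^sub>0 'k"
    where "a = bas (1, 1)" "P = bas (2, 0)" "Q = bas (0, 2)"
      "h = Poly_Mapping.single 0 (- (1/2))"
  have W: "DH2_comult_Y = h * a * (1 + P + Q - P * Q)"
    by (simp add: DH2_comult_Y_def scale_eq_mult a_P_Q_h_def algebra_simps mult_single)
  have PQ: "P * P = 1" "Q * Q = 1"
    by (simp_all add: a_P_Q_h_def mult_single four_zero flip: zero_prod_def)
  have h: "h * h * 4 = 1"
  proof -
    have "h * h * 4 = Poly_Mapping.single 0 ((1/2) * (1/2) * 4)"
      by (simp add: a_P_Q_h_def mult_single flip: single_numeral)
    also have "(4::'k) = 2 * 2"
      by simp
    also have "(1/2) * (1/2) * (2 * 2) = (1/2 * 2) * (1/2 * 2 :: 'k)"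
      by (simp only: ac_simps)
    also have "\<dots> = 1"
      using assms by simp
    finally show ?thesis by simp
  qed
  have "(1 + P + Q - P * Q) * (1 + P + Q - P * Q) = 4"
    using PQ by (rule square_aux)
  moreover have "DH2_comult_Y ^ 2 = a * a * (h * h * ((1 + P + Q - P * Q) * (1 + P + Q - P * Q)))"
    unfolding W power2_eq_square by (simp only: ac_simps)
  ultimately have "DH2_comult_Y ^ 2 = a * a"
    using h by simp
  then show ?thesis by (simp add: a_P_Q_h_def mult_single)
qed

text \<open>Congruence modulo the ideal of the presentation.\<close>

definition DH2_cong :: "(nat \<times> nat \<Rightarrow>\<^sub>0 'k::field) \<Rightarrow> (nat \<times> nat \<Rightarrow>\<^sub>0 'k) \<Rightarrow> bool" where
  "DH2_cong p p' \<longleftrightarrow> (\<exists>q r. p - p' = q * (bas (2, 0) - 1) + r * (bas (0, 2) - bas (1, 0)))"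

lemma DH2_cong_refl: "DH2_cong p p"
  unfolding DH2_cong_def by (intro exI[of _ 0]) simp

lemma ideal_add_aux:
  fixes a b c d g h :: "'a::comm_ring_1"
  assumes "p - p' = a * g + b * h" "q - q' = c * g + d * h"
  shows "p + q - (p' + q') = (a + c) * g + (b + d) * h"
proof -
  have "p + q - (p' + q') = (p - p') + (q - q')" by simp
  then show ?thesis unfolding assms by (simp add: algebra_simps)
qed

lemma ideal_mult_aux:
  fixes a b c d g h :: "'a::comm_ring_1"
  assumes "p - p' = a * g + b * h" "q - q' = c * g + d * h"
  shows "p * q - p' * q' = (a * q + p' * c) * g + (b * q + p' * d) * h"
proof -
  have "p * q - p' * q' = (p - p') * q + p' * (q - q')" by (simp add: algebra_simps)
  then show ?thesis unfolding assms by (simp add: algebra_simps)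
qed

lemma relation_aux: "T ^ 4 - 1 = 1 * (S ^ 2 - 1) + (T ^ 2 + S) * (T ^ 2 - S)"
  for S T :: "'a::comm_ring_1"
  by (simp add: algebra_simps power2_eq_square power4_eq_xxxx)

lemma DH2_cong_add: "DH2_cong p p' \<Longrightarrow> DH2_cong q q' \<Longrightarrow> DH2_cong (p + q) (p' + q')"
  unfolding DH2_cong_def
proof (elim exE)
  fix a b c d
  assume "p - p' = a * (bas (2, 0) - 1) + b * (bas (0, 2) - bas (1, 0))"
    "q - q' = c * (bas (2, 0) - 1) + d * (bas (0, 2) - bas (1, 0))"
  then have "p + q - (p' + q') = (a + c) * (bas (2, 0) - 1) + (b + d) * (bas (0, 2) - bas (1, 0))"
    by (rule ideal_add_aux)
  then show "\<exists>a b. p + q - (p' + q') = a * (bas (2, 0) - 1) + b * (bas (0, 2) - bas (1, 0))"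
    by blast
qed

lemma DH2_cong_mult: "DH2_cong p p' \<Longrightarrow> DH2_cong q q' \<Longrightarrow> DH2_cong (p * q) (p' * q')"
  unfolding DH2_cong_def
proof (elim exE)
  fix a b c d
  assume "p - p' = a * (bas (2, 0) - 1) + b * (bas (0, 2) - bas (1, 0))"
    "q - q' = c * (bas (2, 0) - 1) + d * (bas (0, 2) - bas (1, 0))"
  then have "p * q - p' * q' =
      (a * q + p' * c) * (bas (2, 0) - 1) + (b * q + p' * d) * (bas (0, 2) - bas (1, 0))"
    by (rule ideal_mult_aux)
  then show "\<exists>a b. p * q - p' * q' = a * (bas (2, 0) - 1) + b * (bas (0, 2) - bas (1, 0))"
    by blast
qed

lemma DH2_cong_trans: "DH2_cong p q \<Longrightarrow> DH2_cong q r \<Longrightarrow> DH2_cong p r"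
  using DH2_cong_add[of p q q r] by (simp add: DH2_cong_def algebra_simps)

lemma DH2_cong_power: "DH2_cong p q \<Longrightarrow> DH2_cong (p ^ n) (q ^ n)"
  by (induction n) (auto intro: DH2_cong_refl DH2_cong_mult)

lemma bas_power: "bas a ^ n = bas (((+) a ^^ n) 0)" for a :: "'a::monoid_add"
  by (induction n) (simp_all add: mult_single)

lemma monomial: "bas (m, n) = bas (1, 0) ^ m * (bas (0, 1) ^ n :: nat \<times> nat \<Rightarrow>\<^sub>0 'k::field)"
proof -
  have "((+) (1, 0) ^^ m) 0 = (m, 0::nat)" for m :: nat
    by (induction m) (auto simp: zero_prod_def)
  moreover have "((+) (0, 1) ^^ n) 0 = (0::nat, n)" for n :: nat
    by (induction n) (auto simp: zero_prod_def)
  ultimately show ?thesis by (simp add: bas_power mult_single del: One_nat_def)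
qed

lemma DH2_cong_monomial:
  "DH2_cong (bas (m, n)) (bas (0, (2 * m + n) mod 4) :: nat \<times> nat \<Rightarrow>\<^sub>0 'k::field)"
proof -
  define S T :: "nat \<times> nat \<Rightarrow>\<^sub>0 'k" where "S = bas (1, 0)" "T = bas (0, 1)"
  have gens: "bas (2, 0) = S ^ 2" "bas (0, 2) = T ^ 2"
    by (simp_all add: S_T_def power2_eq_square mult_single numeral_2_eq_2)
  have "S - T ^ 2 = 0 * (S ^ 2 - 1) + (- 1) * (T ^ 2 - S)"
    by simp
  then have ST: "DH2_cong S (T ^ 2)"
    unfolding DH2_cong_def gens S_T_def(1)[symmetric] by (intro exI)
  have "T ^ 4 - 1 = 1 * (S ^ 2 - 1) + (T ^ 2 + S) * (T ^ 2 - S)"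
    by (rule relation_aux)
  then have T4: "DH2_cong (T ^ 4) 1"
    unfolding DH2_cong_def gens S_T_def(1)[symmetric] by (intro exI)
  let ?d = "(2 * m + n) div 4" and ?r = "(2 * m + n) mod 4"
  have "DH2_cong (S ^ m * T ^ n) ((T ^ 2) ^ m * T ^ n)"
    by (intro DH2_cong_mult DH2_cong_power ST DH2_cong_refl)
  also have "(T ^ 2) ^ m * T ^ n = T ^ (2 * m + n)"
    by (simp only: power_mult power_add)
  also have "2 * m + n = 4 * ?d + ?r"
    by simp
  also have "T ^ (4 * ?d + ?r) = (T ^ 4) ^ ?d * T ^ ?r"
    by (simp only: power_add power_mult)
  finally have "DH2_cong (S ^ m * T ^ n) ((T ^ 4) ^ ?d * T ^ ?r)" .
  moreover have "DH2_cong ((T ^ 4) ^ ?d * T ^ ?r) (1 ^ ?d * T ^ ?r)"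
    by (intro DH2_cong_mult DH2_cong_power T4 DH2_cong_refl)
  ultimately have "DH2_cong (S ^ m * T ^ n) (1 ^ ?d * T ^ ?r)"
    by (rule DH2_cong_trans)
  moreover have "bas (m, n) = S ^ m * T ^ n"
    unfolding S_T_def by (rule monomial)
  moreover have "1 ^ ?d * T ^ ?r = bas (0, ?r)"
    unfolding S_T_def by (subst monomial[of 0]) simp
  ultimately show ?thesis
    by simp
qed

lemma expo_of_nat: "expo (of_nat n) = n mod 4"
proof -
  have *: "of_nat (n mod 4) = (of_nat n :: 4)"
  proof -
    have "(of_nat n :: 4) = of_nat (4 * (n div 4) + n mod 4)" by simp
    also have "\<dots> = of_nat (n mod 4)"
      by (simp only: of_nat_add of_nat_mult of_nat_numeral four_zero) simp
    finally show ?thesis ..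
  qed
  have "n mod 4 = 0 \<or> n mod 4 = 1 \<or> n mod 4 = 2 \<or> n mod 4 = 3" by presburger
  then show ?thesis unfolding *[symmetric] by (auto simp: expo_def)
qed

lemma of_nat_expo: "of_nat (expo r) = r"
  using exhaust_type4[of r] by (auto simp: expo_def)

lemma DH2_model_simps [simp]:
  "mul DH2_model = (*)" "unt DH2_model = 1"
  "mul (alg2 DH2_model) = (*)" "unt (alg2 DH2_model) = 1"
  by (simp_all add: tensor_monoid_algebra DH2_model_def Let_def)

lemma eval2_DH2_model_bas:
  "eval2 DH2_model (bas 2) (bas 1) (bas (m, n)) = (bas (of_nat (2 * m + n)) :: 4 \<Rightarrow>\<^sub>0 'k::field)"
proof -
  have pow: "alg_power DH2_model u n = u ^ n" for u :: "4 \<Rightarrow>\<^sub>0 'k" and n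
    by (induction n) (simp_all add: alg_power_def)
  have "((+) (a::4) ^^ n) 0 = of_nat n * a" for a n
    by (induction n) (simp_all add: algebra_simps)
  then show ?thesis
    by (simp add: eval2_def pow bas_power mult_single algebra_simps)
qed

lemma DH2_model_presented: "DH2_presented (DH2_model :: (4, 'k::field) qha) (bas 2) (bas 1)"
proof -
  let ?D = "DH2_model :: (4, 'k) qha"
  let ?ev = "eval2 ?D (bas 2) (bas 1)"
  have ev_add: "?ev (p + q) = ?ev p + ?ev q" and ev_scale: "?ev (scale c p) = scale c (?ev p)" for c p q
    by (simp_all add: eval2_def lin_ext_add lin_ext_scale)
  have ev_0: "?ev 0 = 0" by (simp add: eval2_def)
  have ev_bas_mult: "?ev (bas a * q) = ?ev (bas a) * ?ev q" for a q
  proof (induction q rule: bas_induct)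
    case (bas b)
    then show ?case
      by (cases a; cases b) (simp add: mult_single eval2_DH2_model_bas algebra_simps)
  qed (simp_all add: ev_add ev_scale ev_0 distrib_left scale_mult_right)
  have ev_mult: "?ev (p * q) = ?ev p * ?ev q" for p q
    by (induction p rule: bas_induct)
      (simp_all add: ev_add ev_scale ev_0 distrib_right scale_mult_left ev_bas_mult)
  have ev_1: "?ev 1 = 1"
    using eval2_DH2_model_bas[of 0 0, where 'k = 'k] by (simp flip: zero_prod_def)
  have ev_diff: "?ev (p - q) = ?ev p - ?ev q" for p q
    using ev_add[of "p - q" q] by simp
  have "is_alg ?D"
    by (simp add: is_alg_def lin_iff algebra_simps scale_mult_left scale_mult_right)
  moreover have "v \<in> range ?ev" for v
  proof (induction v rule: bas_induct)
    case zero
    show ?case using ev_0 by (intro range_eqI[of _ _ 0]) simp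
  next
    case (add u v)
    then obtain p q where "u = ?ev p" "v = ?ev q" by blast
    then show ?case by (intro range_eqI[of _ _ "p + q"]) (simp only: ev_add)
  next
    case (scale c u)
    then obtain p where "u = ?ev p" by blast
    then show ?case by (intro range_eqI[of _ _ "scale c p"]) (simp only: ev_scale)
  next
    case (bas r)
    show ?case
      by (intro range_eqI[of _ _ "bas (0, expo r)"]) (simp add: eval2_DH2_model_bas of_nat_expo)
  qed
  then have "surj ?ev" by blast
  moreover have "DH2_cong p (lin_ext (\<lambda>r. bas (0, expo r)) (?ev p))" for p
  proof (induction p rule: bas_induct)
    case (scale c p)
    then show ?case
      using DH2_cong_mult[OF DH2_cong_refl]
      by (simp add: ev_scale lin_ext_scale) (simp add: scale_eq_mult)
  next
    case (bas a)
    then show ?case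
      using DH2_cong_monomial by (cases a) (simp add: eval2_DH2_model_bas expo_of_nat del: of_nat_add of_nat_mult)
  qed (simp_all add: ev_0 ev_add lin_ext_add DH2_cong_refl DH2_cong_add)
  then have "DH2_cong p 0" if "?ev p = 0" for p
    using that by (metis lin_ext_zero)
  then have "\<exists>q r. p = q * (bas (2, 0) - 1) + r * (bas (0, 2) - bas (1, 0))" if "?ev p = 0" for p
    using that unfolding DH2_cong_def by simp
  moreover have "?ev (q * (bas (2, 0) - 1) + r * (bas (0, 2) - bas (1, 0))) = 0" for q r
    by (simp add: ev_add ev_mult ev_diff ev_1 eval2_DH2_model_bas four_zero)
  ultimately show ?thesis
    unfolding DH2_presented_def DH2_model_simps by (blast intro: mult.commute)
qed

lemma is_DH2_model:
  assumes "(2::'k::field) \<noteq> 0"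
  shows "is_DH2 (DH2_model :: (4, 'k) qha) (bas 2) (bas 1)"
proof -
  let ?D = "DH2_model :: (4, 'k) qha"
  let ?W = "DH2_comult_Y :: 4 \<times> 4 \<Rightarrow>\<^sub>0 'k"
  have comult: "comult ?D = lin_ext (\<lambda>r. ?W ^ expo r)"
    and counit: "counit ?D = lin_form (\<lambda>r. (-1) ^ expo r)"
    by (simp_all add: DH2_model_def Let_def)
  have "?W ^ 4 = (?W ^ 2) ^ 2" by (simp flip: power_mult)
  also have "\<dots> = 1"
    by (simp only: DH2_comult_Y_square[OF assms])
      (simp add: power2_eq_square mult_single four_zero flip: zero_prod_def)
  finally have W4: "?W ^ 4 = 1" .
  have "comult ?D (bas r * v) = comult ?D (bas r) * comult ?D v" for r v
    by (induction v rule: bas_induct)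
      (simp_all add: comult lin_ext_add lin_ext_scale distrib_left scale_mult_right mult_single
        power_expo_add[OF W4])
  then have "comult ?D (u * v) = comult ?D u * comult ?D v" for u v
    by (induction u rule: bas_induct)
      (simp_all add: comult lin_ext_add lin_ext_scale distrib_right scale_mult_left)
  moreover have "comult ?D 1 = 1"
    using lin_ext_bas[of "\<lambda>r. ?W ^ expo r" 0] by (simp add: comult expo_def)
  ultimately have "alg_hom ?D (alg2 ?D) (comult ?D)"
    by (simp add: alg_hom_def comult lin_lin_ext)
  moreover have "counit ?D (bas r * v) = counit ?D (bas r) * counit ?D v" for r v
    by (induction v rule: bas_induct)
      (simp_all add: counit lin_form_add lin_form_scale distrib_left scale_mult_right mult_single
        power_expo_add)
  then have "counit ?D (u * v) = counit ?D u * counit ?D v" for u v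
    by (induction u rule: bas_induct)
      (simp_all add: counit lin_form_add lin_form_scale distrib_right scale_mult_left)
  moreover have "counit ?D 1 = 1"
    using lin_form_bas[of "\<lambda>r. (-1 :: 'k) ^ expo r" 0] by (simp add: counit expo_def)
  ultimately have "alg_char ?D (counit ?D)"
    by (simp add: alg_char_def counit lin_lin_form)
  moreover have "alg_hom ?D (alg2 ?D) (comult ?D)" by fact
  moreover have "comult ?D (bas 2) = bas 2 \<otimes> bas 2"
    using DH2_comult_Y_square[OF assms] by (simp add: comult expo_def)
  moreover have "comult ?D (bas 1) = ?W"
    by (simp add: comult expo_def)
  moreover have "counit ?D (bas 2) = 1" "counit ?D (bas 1) = -1"
    by (simp_all add: counit expo_def)
  moreover have "reassoc ?D = unt (alg3 ?D)
      - scale 2 (p_minus ?D (bas 2) \<otimes> p_minus ?D (bas 2) \<otimes> p_minus ?D (bas 2))"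
    by (simp add: DH2_model_def Let_def tensor_alg_def p_minus_def)
  moreover have "antip ?D = id" "alph ?D = bas 2" "bet ?D = unt ?D"
    by (simp_all add: DH2_model_def Let_def)
  moreover have "?W = scale (- (1/2)) (bas 1 \<otimes> bas 1 + (bas 2 \<cdot>\<^bsub>?D\<^esub> bas 1) \<otimes> bas 1
      + bas 1 \<otimes> (bas 2 \<cdot>\<^bsub>?D\<^esub> bas 1) - (bas 2 \<cdot>\<^bsub>?D\<^esub> bas 1) \<otimes> (bas 2 \<cdot>\<^bsub>?D\<^esub> bas 1))"
    by (simp add: DH2_comult_Y_def mult_single)
  ultimately show ?thesis
    using DH2_model_presented[where 'k = 'k] unfolding is_DH2_def Let_def by (intro conjI) simp_all
qed

end

theory Submission
  imports Defs
begin

text \<open>All algebras involved are commutative and their characters separate points, also on tensor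
  powers, so every identity can be checked on values of characters.  The characters of
  \<open>H(2) \<otimes> H(2)\<close> form the group \<open>C\<^sub>2 \<times> C\<^sub>2\<close>; its reassociator, antipode elements and twists become
  functions on powers of this group, and the quasi-Hopf axioms become the cocycle condition and
  its companions.  Composing with \<open>\<zeta>\<^sub>\<plusminus>\<close> describes \<open>D(H(2))\<close> by functions on the same group, and
  these turn out to be those of the twisted tensor square: both reassociators are the sign
  cocycle pulled back along the product map \<open>C\<^sub>2 \<times> C\<^sub>2 \<rightarrow> C\<^sub>2\<close>.\<close>

section \<open>Linear forms on tensor products\<close>

abbreviation linear_form :: "(('a \<Rightarrow>\<^sub>0 'k::field) \<Rightarrow> 'k) \<Rightarrow> bool"
  where "linear_form \<equiv> Vector_Spaces.linear scale (*)"

lemma linear_form_add: "linear_form f \<Longrightarrow> f (u + v) = f u + f v"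
  and linear_form_scale: "linear_form f \<Longrightarrow> f (scale c u) = c * f u"
  by (simp_all add: lin_form_iff)

lemma linear_form_zero: "linear_form f \<Longrightarrow> f 0 = 0"
  using linear_form_scale[of f 0 0] by simp

lemma linear_form_diff: "linear_form f \<Longrightarrow> f (u - v) = f u - f v"
  using linear_form_add[of f "u - v" v] by simp

lemmas linear_form_simps =
  linear_form_add linear_form_scale linear_form_zero linear_form_diff

lemma linear_form_lin_ext:
  assumes f: "linear_form f"
  shows "f (lin_ext F u) = lin_form (\<lambda>a. f (F a)) u"
  by (induction u rule: bas_induct)
    (simp_all add: linear_form_simps[OF f] lin_ext_add lin_ext_scale lin_form_add lin_form_scale)

lemma lin_form_basis:
  assumes f: "linear_form f"
  shows "lin_form (\<lambda>a. f (bas a)) u = f u"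
  by (induction u rule: bas_induct)
    (simp_all add: linear_form_simps[OF f] lin_form_add lin_form_scale)

lemma lin_form_mult_left: "lin_form (\<lambda>a. c * F a) u = c * lin_form F u"
  and lin_form_mult_right: "lin_form (\<lambda>a. F a * c) u = lin_form F u * c"
  by (induction u rule: bas_induct) (simp_all add: lin_form_add lin_form_scale algebra_simps)

text \<open>Only basis values enter, as in \<open>tmap\<close>, so that \<open>tform_tmap\<close>
  can absorb arbitrary maps on the factors. Linearity of the forms is what gives the product formula
  on pure tensors.\<close>

definition tform :: "(('a \<Rightarrow>\<^sub>0 'k::field) \<Rightarrow> 'k) \<Rightarrow> (('b \<Rightarrow>\<^sub>0 'k) \<Rightarrow> 'k) \<Rightarrow> ('a \<times> 'b \<Rightarrow>\<^sub>0 'k) \<Rightarrow> 'k"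
    (infixr \<open>\<odot>\<close> 75)
  where "f \<odot> g = lin_form (\<lambda>(a, b). f (bas a) * g (bas b))"

lemma linear_form_tform [simp]: "linear_form (f \<odot> g)"
  by (simp add: tform_def lin_lin_form)

lemma tform_bas [simp]: "(f \<odot> g) (bas p) = f (bas (fst p)) * g (bas (snd p))"
  by (simp add: tform_def case_prod_unfold)

lemma tform_tens:
  assumes f: "linear_form f" and g: "linear_form g"
  shows "(f \<odot> g) (u \<otimes> v) = f u * g v"
  by (simp add: tens_def linear_form_lin_ext[OF linear_form_tform]
      lin_form_mult_left lin_form_mult_right lin_form_basis[OF f] lin_form_basis[OF g])

lemma tform_tmap:
  assumes "linear_form f" "linear_form g"
  shows "(f \<odot> g) (tmap p q t) = ((\<lambda>u. f (p u)) \<odot> (\<lambda>v. g (q v))) t"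
  by (simp add: tmap_def linear_form_lin_ext[OF linear_form_tform] case_prod_unfold tform_tens assms)
    (simp add: tform_def case_prod_unfold)

lemma linear_form_comp:
  assumes "linear_form f" "lin p"
  shows "linear_form (\<lambda>u. f (p u))"
  using assms by (simp add: lin_form_iff lin_iff)

lemma linear_form_relabel:
  assumes f: "linear_form f"
  shows "f (relabel r u) = lin_form (\<lambda>a. f (bas (r a))) u"
  by (simp add: relabel_def linear_form_lin_ext[OF f])

lemma tform_assoc: "(f \<odot> g \<odot> h) (assoc t) = ((f \<odot> g) \<odot> h) t"
  by (simp add: assoc_def linear_form_relabel[OF linear_form_tform] case_prod_unfold mult.assoc
      tform_def[of "f \<odot> g"])

lemma tform_assoc3: "(f \<odot> g \<odot> h \<odot> l) (assoc3 t) = ((f \<odot> g \<odot> h) \<odot> l) t"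
  by (simp add: assoc3_def linear_form_relabel[OF linear_form_tform] case_prod_unfold mult.assoc
      tform_def[of "f \<odot> g \<odot> h"])

lemma tform_contract_left:
  assumes f: "linear_form f"
  shows "f (contract_left e t) = (e \<odot> f) t"
  by (simp add: contract_left_def linear_form_lin_ext[OF f] tform_def case_prod_unfold
      linear_form_simps[OF f])

lemma tform_contract_right:
  assumes f: "linear_form f"
  shows "f (contract_right e t) = (f \<odot> e) t"
  by (simp add: contract_right_def linear_form_lin_ext[OF f] tform_def case_prod_unfold
      linear_form_simps[OF f] mult.commute)


section \<open>Algebras separated by their characters\<close>

lemma alg_charD:
  assumes "alg_char A f"
  shows "linear_form f" "f (u \<cdot>\<^bsub>A\<^esub> v) = f u * f v" "f (unt A) = 1"
  using assms by (simp_all add: alg_char_def)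

lemma alg_char_comp: "alg_char B f \<Longrightarrow> alg_hom A B p \<Longrightarrow> alg_char A (\<lambda>u. f (p u))"
  by (simp add: alg_char_def alg_hom_def linear_form_comp)

lemma alg_char_tform:
  assumes "alg_char A f" "alg_char B g"
  shows "alg_char (tensor_alg A B) (f \<odot> g)"
  unfolding alg_char_def
proof (intro conjI allI)
  note f = alg_charD[OF assms(1)] and g = alg_charD[OF assms(2)]
  fix s t
  have "(f \<odot> g) (s \<cdot>\<^bsub>tensor_alg A B\<^esub> t) =
      lin_form (\<lambda>p. lin_form (\<lambda>q. f (bas (fst p)) * g (bas (snd p)) * (f (bas (fst q)) * g (bas (snd q)))) t) s"
    by (simp add: tensor_alg_def linear_form_lin_ext[OF linear_form_tform] case_prod_unfold tform_tens f g ac_simps)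
  then show "(f \<odot> g) (s \<cdot>\<^bsub>tensor_alg A B\<^esub> t) = (f \<odot> g) s * (f \<odot> g) t"
    by (simp add: lin_form_mult_left lin_form_mult_right tform_def case_prod_unfold)
  show "(f \<odot> g) (unt (tensor_alg A B)) = 1"
    by (simp add: tensor_alg_def tform_tens f g)
qed simp

text \<open>Evaluation at all \<open>e j\<close> then embeds \<open>A\<close> into the functions on
  the index type, so bilinearity, associativity, unit laws and commutativity are inherited from the
  field.\<close>

definition separating_chars ::
    "('a, 'k::field, 'm) alg_scheme \<Rightarrow> ('g \<Rightarrow> ('a \<Rightarrow>\<^sub>0 'k) \<Rightarrow> 'k) \<Rightarrow> bool" where
  "separating_chars A e \<longleftrightarrow>
     (\<forall>j. alg_char A (e j)) \<and> (\<forall>u v. (\<forall>j. e j u = e j v) \<longrightarrow> u = v)"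

lemma separating_charsD:
  assumes "separating_chars A e"
  shows "alg_char A (e j)" "linear_form (e j)"
    "e j (u \<cdot>\<^bsub>A\<^esub> v) = e j u * e j v" "e j (unt A) = 1"
  using assms by (auto simp: separating_chars_def intro: alg_charD)

lemma separating_charsI:
  assumes "separating_chars A e" "\<And>j. e j u = e j v"
  shows "u = v"
  using assms by (simp add: separating_chars_def)

text \<open>A tensor killed by all \<^term>\<open>e j \<odot> f l\<close> has zero partial evaluations
  \<^term>\<open>contract_left (e j) t\<close>, because the \<^term>\<open>f l\<close> separate; since the \<^term>\<open>e j\<close> separate too,
  every coefficient slice of \<^term>\<open>t\<close> along the second basis vanishes.\<close>

lemma separating_chars_tensor:
  fixes A :: "('a, 'k::field, 'm) alg_scheme" and B :: "('b, 'k, 'n) alg_scheme"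
  assumes e: "separating_chars A e" and f: "separating_chars B f"
  shows "separating_chars (tensor_alg A B) (\<lambda>p. e (fst p) \<odot> f (snd p))"
proof -
  have zero: "t = 0" if t: "\<And>j l. (e j \<odot> f l) t = 0" for t :: "'a \<times> 'b \<Rightarrow>\<^sub>0 'k"
  proof (rule poly_mapping_eqI)
    fix p :: "'a \<times> 'b"
    obtain a b where p: "p = (a, b)" by (cases p)
    define slice :: "('a \<times> 'b \<Rightarrow>\<^sub>0 'k) \<Rightarrow> ('a \<Rightarrow>\<^sub>0 'k)"
      where "slice = lin_ext (\<lambda>(a, b'). if b' = b then bas a else 0)"
    have "e j (slice s) = poly_mapping.lookup (contract_left (e j) s) b" for j s
      by (induction s rule: bas_induct)
        (auto simp: slice_def contract_left_def lin_ext_add lin_ext_scale lookup_add lookup_single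
          linear_form_simps[OF separating_charsD(2)[OF e]])
    moreover have "contract_left (e j) t = 0" for j
      by (rule separating_charsI[OF f])
        (simp add: tform_contract_left[OF separating_charsD(2)[OF f]] t linear_form_simps[OF separating_charsD(2)[OF f]])
    ultimately have "slice t = 0"
      by (intro separating_charsI[OF e]) (simp add: linear_form_simps[OF separating_charsD(2)[OF e]])
    moreover have "poly_mapping.lookup (slice s) a = poly_mapping.lookup s (a, b)" for s
      by (induction s rule: bas_induct)
        (auto simp: slice_def lin_ext_add lin_ext_scale lookup_add lookup_single when_def split: if_splits)
    ultimately show "poly_mapping.lookup t p = poly_mapping.lookup 0 p"
      by (metis p lookup_zero)
  qed
  have "u = v" if "\<And>j l. (e j \<odot> f l) u = (e j \<odot> f l) v" for u v
    using zero[of "u - v"] that by (simp add: linear_form_diff[OF linear_form_tform])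
  then show ?thesis
    using separating_charsD(1)[OF e] separating_charsD(1)[OF f]
    by (auto simp: separating_chars_def intro: alg_char_tform)
qed

context
  fixes A :: "('a, 'k::field, 'm) alg_scheme" and e :: "'g \<Rightarrow> ('a \<Rightarrow>\<^sub>0 'k) \<Rightarrow> 'k"
  assumes chars: "separating_chars A e"
begin

lemma separating_chars_is_alg: "is_alg A"
  unfolding is_alg_def lin_iff
  by (intro conjI allI; rule separating_charsI[OF chars])
    (simp_all add: separating_charsD[OF chars] linear_form_simps[OF separating_charsD(2)[OF chars]]
      algebra_simps)

lemma separating_chars_commute: "u \<cdot>\<^bsub>A\<^esub> v = v \<cdot>\<^bsub>A\<^esub> u"
  by (rule separating_charsI[OF chars]) (simp add: separating_charsD[OF chars] mult.commute)

lemma separating_chars_alg_invertible: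
  assumes "\<And>j. e j u * e j v = 1"
  shows "alg_invertible A u"
  unfolding alg_invertible_def
  by (intro exI[of _ v] conjI; rule separating_charsI[OF chars])
    (simp_all add: separating_charsD[OF chars] assms mult.commute[of "e _ v"])

text \<open>The definite description \<open>alg_inv\<close> denotes the inverse because the
  characters determine every value of a right inverse, hence the right inverse itself.\<close>

lemma separating_chars_alg_inv:
  assumes "alg_invertible A u"
  shows "e j u \<noteq> 0" "e j (alg_inv A u) = inverse (e j u)"
proof -
  obtain v where v: "u \<cdot>\<^bsub>A\<^esub> v = unt A" "v \<cdot>\<^bsub>A\<^esub> u = unt A"
    using assms by (auto simp: alg_invertible_def)
  have inv: "e j u \<noteq> 0 \<and> e j v' = inverse (e j u)" if "u \<cdot>\<^bsub>A\<^esub> v' = unt A" for j v'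
  proof -
    have "e j u * e j v' = 1"
      using that by (metis separating_charsD(3,4)[OF chars])
    then show ?thesis
      by (metis inverse_unique mult_zero_left zero_neq_one)
  qed
  have "alg_inv A u = v"
    unfolding alg_inv_def
  proof (rule the_equality)
    show "u \<cdot>\<^bsub>A\<^esub> v = unt A \<and> v \<cdot>\<^bsub>A\<^esub> u = unt A" using v by simp
    show "v' = v" if "u \<cdot>\<^bsub>A\<^esub> v' = unt A \<and> v' \<cdot>\<^bsub>A\<^esub> u = unt A" for v'
      using inv[OF v(1)] inv[of v'] that by (intro separating_charsI[OF chars]) metis
  qed
  then show "e j u \<noteq> 0" "e j (alg_inv A u) = inverse (e j u)"
    using inv[OF v(1)] by auto
qed

end


section \<open>Quasi-Hopf algebras of functions on a group\<close>
text \<open>When the \<^term>\<open>e j\<close> are the point evaluations of a finite group, \<^term>\<open>H\<close> is the algebra of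
  functions on this group, with reassociator the function \<^term>\<open>\<phi>\<close>.\<close>

locale function_qha =
  fixes H :: "('b, 'k::field) qha"
    and e :: "'g::ab_group_add \<Rightarrow> ('b \<Rightarrow>\<^sub>0 'k) \<Rightarrow> 'k"
    and \<phi> :: "'g \<Rightarrow> 'g \<Rightarrow> 'g \<Rightarrow> 'k"
    and a b :: "'g \<Rightarrow> 'k"
  assumes chars: "separating_chars H e"
    and comult: "(e j \<odot> e k) (comult H h) = e (j + k) h"
    and counit: "counit H h = e 0 h"
    and reassoc: "(e j \<odot> e k \<odot> e l) (reassoc H) = \<phi> j k l"
    and antip: "e j (antip H h) = e (- j) h"
    and alph: "e j (alph H) = a j"
    and bet: "e j (bet H) = b j"
begin

lemmas chars2 = separating_chars_tensor[OF chars chars]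
lemmas chars3 = separating_chars_tensor[OF chars chars2]
lemmas chars4 = separating_chars_tensor[OF chars chars3]

lemma char: "alg_char H (e j)"
  and char2: "alg_char (alg2 H) (e j \<odot> e k)"
  and char3: "alg_char (alg3 H) (e j \<odot> e k \<odot> e l)"
  and char4: "alg_char (alg4 H) (e j \<odot> e k \<odot> e l \<odot> e m)"
  by (intro alg_char_tform separating_charsD(1)[OF chars])+

lemmas lin_char [simp] = alg_charD(1)[OF char]

lemmas char_simps =
  alg_charD(2,3)[OF char] alg_charD(2,3)[OF char2] alg_charD(2,3)[OF char3]
  alg_charD(2,3)[OF char4] linear_form_simps[OF lin_char] linear_form_simps[OF linear_form_tform]

lemma eqI: "(\<And>j. e j u = e j v) \<Longrightarrow> u = v"
  by (rule separating_charsI[OF chars])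

lemma eq2I: "(\<And>j k. (e j \<odot> e k) s = (e j \<odot> e k) t) \<Longrightarrow> s = t"
  by (rule separating_charsI[OF chars2])

lemma eq3I: "(\<And>j k l. (e j \<odot> e k \<odot> e l) s = (e j \<odot> e k \<odot> e l) t) \<Longrightarrow> s = t"
  by (rule separating_charsI[OF chars3])

lemma eq4I:
  "(\<And>j k l m. (e j \<odot> e k \<odot> e l \<odot> e m) s = (e j \<odot> e k \<odot> e l \<odot> e m) t) \<Longrightarrow> s = t"
  by (rule separating_charsI[OF chars4])

lemma counit_eq: "counit H = e 0"
  by (rule ext) (rule counit)

lemma alg_inv2:
  assumes "alg_invertible (alg2 H) F"
  shows "(e j \<odot> e k) F \<noteq> 0" "(e j \<odot> e k) (alg_inv (alg2 H) F) = inverse ((e j \<odot> e k) F)"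
  using separating_chars_alg_inv[OF chars2 assms, of "(j, k)"] by simp_all

lemma alg_inv3:
  assumes "alg_invertible (alg3 H) T"
  shows "(e j \<odot> e k \<odot> e l) T \<noteq> 0"
    "(e j \<odot> e k \<odot> e l) (alg_inv (alg3 H) T) = inverse ((e j \<odot> e k \<odot> e l) T)"
  using separating_chars_alg_inv[OF chars3 assms, of "(j, k, l)"] by simp_all

text \<open>The antipode turns \<open>e j\<close> into \<open>e (- j)\<close> on its leg, and
  commutativity pulls out \<open>alph\<close>. The tensor \<open>t\<close> is arbitrary because both
  coproducts and inverse twists are inserted below.\<close>

lemma char_antip_alph:
  "e j (lin_ext (\<lambda>(p, q). antip H (bas p) \<cdot>\<^bsub>H\<^esub> alph H \<cdot>\<^bsub>H\<^esub> bas q) t) = (e (- j) \<odot> e j) t * a j"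
  by (simp add: linear_form_lin_ext[OF lin_char] case_prod_unfold char_simps antip alph tform_def
      ac_simps lin_form_mult_left)

lemma char_bet_antip:
  "e j (lin_ext (\<lambda>(p, q). bas p \<cdot>\<^bsub>H\<^esub> bet H \<cdot>\<^bsub>H\<^esub> antip H (bas q)) t) = (e j \<odot> e (- j)) t * b j"
  by (simp add: linear_form_lin_ext[OF lin_char] case_prod_unfold char_simps antip bet tform_def
      ac_simps lin_form_mult_left)

lemma char_bet_antip_alph:
  "e j (lin_ext (\<lambda>(p, q, r). bas p \<cdot>\<^bsub>H\<^esub> bet H \<cdot>\<^bsub>H\<^esub> antip H (bas q) \<cdot>\<^bsub>H\<^esub> alph H \<cdot>\<^bsub>H\<^esub> bas r) t)
     = (e j \<odot> e (- j) \<odot> e j) t * (a j * b j)"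
  by (simp add: linear_form_lin_ext[OF lin_char] case_prod_unfold char_simps antip alph bet
      tform_def[of "e j" "_ \<odot> _"] ac_simps lin_form_mult_left)

lemma char_antip_alph_bet_antip:
  "e j (lin_ext (\<lambda>(p, q, r).
        antip H (bas p) \<cdot>\<^bsub>H\<^esub> alph H \<cdot>\<^bsub>H\<^esub> bas q \<cdot>\<^bsub>H\<^esub> bet H \<cdot>\<^bsub>H\<^esub> antip H (bas r)) t)
     = (e (- j) \<odot> e j \<odot> e (- j)) t * (a j * b j)"
  by (simp add: linear_form_lin_ext[OF lin_char] case_prod_unfold char_simps antip alph bet
      tform_def[of "e (- j)" "_ \<odot> _"] ac_simps lin_form_mult_left)

text \<open>Beyond invertibility, the hypotheses are the values at characters of the pentagon, of
  the counit condition on the reassociator and of its two antipode identities. All other axioms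
  reduce to the group laws of the index.\<close>

lemma quasi_hopf:
  assumes inv: "alg_invertible (alg3 H) (reassoc H)"
    and cocycle: "\<And>j k l m. \<phi> k l m * \<phi> j (k + l) m * \<phi> j k l = \<phi> j k (l + m) * \<phi> (j + k) l m"
    and normalised: "\<And>j k. \<phi> j 0 k = 1"
    and antipode: "\<And>j. \<phi> j (- j) j * (a j * b j) = 1" "\<And>j. inverse (\<phi> (- j) j (- j)) * (a j * b j) = 1"
  shows "quasi_hopf H"
proof -
  note inv3 = alg_inv3[OF inv, unfolded reassoc]
  have "is_alg H"
    by (rule separating_chars_is_alg[OF chars])
  moreover have "alg_hom H (alg2 H) (comult H)"
    unfolding alg_hom_def lin_iff by (intro conjI allI; rule eq2I) (simp_all add: comult char_simps)
  moreover have "alg_char H (counit H)"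
    unfolding counit_eq by (rule char)
  moreover have "tmap id (comult H) (comult H h) =
        reassoc H \<cdot>\<^bsub>alg3 H\<^esub> assoc (tmap (comult H) id (comult H h))
          \<cdot>\<^bsub>alg3 H\<^esub> alg_inv (alg3 H) (reassoc H)" for h
    \<comment> \<open>Conjugation is trivial in a commutative algebra, so only associativity of the
      index group remains.\<close>
    by (rule eq3I) (simp add: tform_tmap tform_assoc comult reassoc inv3 char_simps add.assoc)
  moreover have "contract_right (counit H) (comult H h) = h" for h
    by (rule eqI) (simp add: tform_contract_right[OF lin_char] counit_eq comult)
  moreover have "contract_left (counit H) (comult H h) = h" for h
    by (rule eqI) (simp add: tform_contract_left[OF lin_char] counit_eq comult)
  moreover have "(unt H \<otimes> reassoc H)
         \<cdot>\<^bsub>alg4 H\<^esub> tmap id (\<lambda>t. assoc (tmap (comult H) id t)) (reassoc H)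
         \<cdot>\<^bsub>alg4 H\<^esub> assoc3 (reassoc H \<otimes> unt H)
       = tmap id (tmap id (comult H)) (reassoc H)
         \<cdot>\<^bsub>alg4 H\<^esub> assoc (tmap (comult H) id (reassoc H))"
    by (rule eq4I)
      (simp add: tform_tmap tform_assoc tform_assoc3 tform_tens comult reassoc char_simps cocycle)
  moreover have "tmap id (contract_left (counit H)) (reassoc H) = unt H \<otimes> unt H"
    by (rule eq2I)
      (simp add: tform_tmap tform_tens tform_contract_left[OF lin_char] counit_eq reassoc
        char_simps normalised)
  ultimately have "quasi_bialgebra H"
    using inv by (simp add: quasi_bialgebra_def)
  moreover have "alg_antihom H H (antip H)"
    unfolding alg_antihom_def lin_iff
    by (intro conjI allI; rule eqI) (simp_all add: antip char_simps mult.commute)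
  moreover have "lin_ext (\<lambda>(a, b). antip H (bas a) \<cdot>\<^bsub>H\<^esub> alph H \<cdot>\<^bsub>H\<^esub> bas b) (comult H h)
      = scale (counit H h) (alph H)" for h
    \<comment> \<open>A coproduct evaluated at \<open>(- j, j)\<close> is \<open>e 0\<close>, which
      is the counit.\<close>
    by (rule eqI) (simp add: char_antip_alph comult counit char_simps alph)
  moreover have "lin_ext (\<lambda>(a, b). bas a \<cdot>\<^bsub>H\<^esub> bet H \<cdot>\<^bsub>H\<^esub> antip H (bas b)) (comult H h)
      = scale (counit H h) (bet H)" for h
    by (rule eqI) (simp add: char_bet_antip comult counit char_simps bet)
  moreover have "lin_ext (\<lambda>(a, b, c).
      bas a \<cdot>\<^bsub>H\<^esub> bet H \<cdot>\<^bsub>H\<^esub> antip H (bas b) \<cdot>\<^bsub>H\<^esub> alph H \<cdot>\<^bsub>H\<^esub> bas c) (reassoc H) = unt H"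
    by (rule eqI) (simp add: char_bet_antip_alph reassoc char_simps antipode)
  moreover have "lin_ext (\<lambda>(a, b, c).
      antip H (bas a) \<cdot>\<^bsub>H\<^esub> alph H \<cdot>\<^bsub>H\<^esub> bas b \<cdot>\<^bsub>H\<^esub> bet H \<cdot>\<^bsub>H\<^esub> antip H (bas c))
      (alg_inv (alg3 H) (reassoc H)) = unt H"
    by (rule eqI) (simp add: char_antip_alph_bet_antip inv3 char_simps antipode)
  ultimately show ?thesis
    by (simp add: quasi_hopf_def)
qed

text \<open>The new reassociator is \<phi> times the multiplicative coboundary of \<open>c\<close>.
  Conjugation by \<open>F\<close> leaves the coproduct unchanged, by commutativity.\<close>

lemma function_qha_twist:
  assumes inv: "alg_invertible (alg2 H) F" and F: "\<And>j k. (e j \<odot> e k) F = c j k"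
  shows "function_qha (twist H F) e
    (\<lambda>j k l. c k l * c j (k + l) * \<phi> j k l * inverse (c (j + k) l) * inverse (c j k))
    (\<lambda>j. inverse (c (- j) j) * a j) (\<lambda>j. c j (- j) * b j)"
proof
  note inv2 = alg_inv2[OF inv, unfolded F]
  show "separating_chars (twist H F) e"
    using chars by (simp add: separating_chars_def alg_char_def twist_def Let_def)
  show "(e j \<odot> e k) (comult (twist H F) h) = e (j + k) h" for j k h
    by (simp add: twist_def Let_def char_simps comult F inv2)
  show "(e j \<odot> e k \<odot> e l) (reassoc (twist H F)) =
      c k l * c j (k + l) * \<phi> j k l * inverse (c (j + k) l) * inverse (c j k)" for j k l
    by (simp add: twist_def Let_def char_simps tform_tens tform_tmap tform_assoc comult reassoc F inv2)
  show "e j (alph (twist H F)) = inverse (c (- j) j) * a j" for j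
    by (simp add: twist_def Let_def char_antip_alph inv2)
  show "e j (bet (twist H F)) = c j (- j) * b j" for j
    by (simp add: twist_def Let_def char_bet_antip F)
qed (simp_all add: twist_def Let_def counit antip)

text \<open>Conjugation by \<open>U\<close> cancels in the antipode, so only \<open>alph\<close> and
  \<open>bet\<close> are rescaled.\<close>

lemma function_qha_change_antip:
  assumes inv: "alg_invertible H U" and U: "\<And>j. e j U = c j"
  shows "function_qha (change_antip H U) e \<phi> (\<lambda>j. c j * a j) (\<lambda>j. b j * inverse (c j))"
proof
  note inv1 = separating_chars_alg_inv[OF chars inv, unfolded U]
  show "separating_chars (change_antip H U) e"
    using chars by (simp add: separating_chars_def alg_char_def change_antip_def)
  show "e j (antip (change_antip H U) h) = e (- j) h" for j h
    by (simp add: change_antip_def char_simps antip U inv1)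
  show "e j (alph (change_antip H U)) = c j * a j" for j
    by (simp add: change_antip_def char_simps alph U)
  show "e j (bet (change_antip H U)) = b j * inverse (c j)" for j
    by (simp add: change_antip_def char_simps bet inv1)
qed (simp_all add: change_antip_def comult counit reassoc)

end

section \<open>Tensor products and isomorphisms of quasi-Hopf algebras of functions\<close>

lemma tform_relabel_pairs:
  "((f \<odot> g) \<odot> (f' \<odot> g')) (relabel (\<lambda>((a, a'), (b, b')). ((a, b), (a', b'))) t)
     = ((f \<odot> f') \<odot> (g \<odot> g')) t"
  by (simp add: linear_form_relabel[OF linear_form_tform] case_prod_unfold ac_simps
      tform_def[of "f \<odot> f'"])

lemma tform_relabel_triples:
  "((f \<odot> g) \<odot> (f' \<odot> g') \<odot> (f'' \<odot> g''))
      (relabel (\<lambda>((a, a', a''), (b, b', b'')). ((a, b), (a', b'), (a'', b''))) t)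
     = ((f \<odot> f' \<odot> f'') \<odot> (g \<odot> g' \<odot> g'')) t"
  by (simp add: linear_form_relabel[OF linear_form_tform] case_prod_unfold ac_simps
      tform_def[of "f \<odot> f' \<odot> f''"])

lemma function_qha_tensor:
  assumes "function_qha H e \<phi> a b" "function_qha K e' \<phi>' a' b'"
  shows "function_qha (tensor_qha H K) (\<lambda>p. e (fst p) \<odot> e' (snd p))
    (\<lambda>p q r. \<phi> (fst p) (fst q) (fst r) * \<phi>' (snd p) (snd q) (snd r))
    (\<lambda>p. a (fst p) * a' (snd p)) (\<lambda>p. b (fst p) * b' (snd p))"
proof -
  interpret H: function_qha H e \<phi> a b by fact
  interpret K: function_qha K e' \<phi>' a' b' by fact
  show ?thesis
  proof
    show "separating_chars (tensor_qha H K) (\<lambda>p. e (fst p) \<odot> e' (snd p))"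
      using separating_chars_tensor[OF H.chars K.chars]
      by (simp add: separating_chars_def alg_char_def tensor_qha_def)
  qed (simp_all add: tensor_qha_def tform_relabel_pairs tform_relabel_triples tform_tmap tform_tens
      H.comult K.comult H.reassoc K.reassoc H.antip K.antip H.alph K.alph H.bet K.bet
      H.counit_eq K.counit_eq flip: tform_def)
qed

text \<open>Both sides carry the same functions on the same group and \<open>f\<close> matches the
  evaluations, so every compatibility, including linearity of \<open>f\<close>, is an equality of
  values in \<open>K\<close>.\<close>

lemma function_qha_iso:
  assumes "function_qha H e \<phi> a b" "function_qha K e' \<phi> a b"
    and f: "\<And>j u. e' j (f u) = e j u" and "bij f" "quasi_hopf H" "quasi_hopf K"
  shows "quasi_hopf_iso H K f"
proof -
  interpret H: function_qha H e \<phi> a b by fact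
  interpret K: function_qha K e' \<phi> a b by fact
  have "alg_hom H K f"
    unfolding alg_hom_def lin_iff
    by (intro conjI allI; rule K.eqI) (simp_all add: f H.char_simps K.char_simps)
  moreover have "comult K (f h) = tmap f f (comult H h)" for h
    by (rule K.eq2I) (simp add: tform_tmap f H.comult K.comult)
  moreover have "reassoc K = tmap f (tmap f f) (reassoc H)"
    by (rule K.eq3I) (simp add: tform_tmap f H.reassoc K.reassoc)
  moreover have "antip K (f h) = f (antip H h)" for h
    by (rule K.eqI) (simp add: f H.antip K.antip)
  moreover have "alph K = f (alph H)" "bet K = f (bet H)"
    by (auto intro!: K.eqI simp: f H.alph K.alph H.bet K.bet)
  ultimately show ?thesis
    using assms(4-) by (simp add: quasi_hopf_iso_def H.counit K.counit f)
qed


section \<open>The characters of \<open>H(2)\<close> and \<open>H(2) \<otimes> H(2)\<close>\<close>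

definition sign :: "bit \<Rightarrow> 'k::field"
  where "sign s = (if s = 1 then -1 else 1)"

lemma sign_simps [simp]: "sign 0 = 1" "sign 1 = -1"
  by (simp_all add: sign_def)

lemma sign_add: "sign (s + t) = sign s * sign t"
  by (cases s; cases t) simp_all

lemma bit_uminus [simp]: "- s = s" for s :: bit
  by (cases s) simp_all

lemma bit_pair_uminus [simp]: "- p = p" for p :: "bit \<times> bit"
  by (simp add: uminus_prod_def)

text \<open>The self-duality of the group: \<open>sign (j * s)\<close> is bimultiplicative in the
  field with two elements, so adding indices multiplies the values of characters on group
  elements.\<close>

definition H2_char :: "bit \<Rightarrow> (bit \<Rightarrow>\<^sub>0 'k::field) \<Rightarrow> 'k"
  where "H2_char j = lin_form (\<lambda>s. sign (j * s))"

lemma linear_form_H2_char: "linear_form (H2_char j)"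
  by (simp add: H2_char_def lin_lin_form)

lemma H2_char_bas [simp]: "H2_char j (bas s) = sign (j * s)"
  by (simp add: H2_char_def)

lemma H2_char_1: "H2_char j 1 = 1"
  using H2_char_bas[of j 0] by simp

lemma H2_char_times: "H2_char j (u * v) = H2_char j u * H2_char j v"
proof (induction u rule: bas_induct)
  case (bas s)
  show ?case
    by (induction v rule: bas_induct)
      (simp_all add: linear_form_simps[OF linear_form_H2_char] bas_mult_bas sign_add
        scale_mult_right distrib_left)
qed (simp_all add: linear_form_simps[OF linear_form_H2_char] scale_mult_left distrib_right)

lemma bit_poly_mapping_expand:
  "u = scale (poly_mapping.lookup u 0) (bas 0) + scale (poly_mapping.lookup u 1) (bas 1)"
  for u :: "bit \<Rightarrow>\<^sub>0 'k::field"
proof (rule poly_mapping_eqI)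
  fix s :: bit
  show "poly_mapping.lookup u s = poly_mapping.lookup
      (scale (poly_mapping.lookup u 0) (bas 0) + scale (poly_mapping.lookup u 1) (bas 1)) s"
    by (cases s) (simp_all add: lookup_add lookup_single del: single_one)
qed

lemma H2_char_lookup: "H2_char j u = poly_mapping.lookup u 0 + sign j * poly_mapping.lookup u 1"
  by (subst bit_poly_mapping_expand[of u])
    (simp add: linear_form_simps[OF linear_form_H2_char] H2_char_1)

text \<open>The generator \<open>y = g \<otimes> 1\<close> sits in the first tensor factor and \<open>x = 1 \<otimes> g\<close> in the second,
  so a character takes the value \<^term>\<open>sign (fst p)\<close> at \<open>y\<close> and \<^term>\<open>sign (snd p)\<close> at \<open>x\<close>.\<close>

definition H22_char :: "bit \<times> bit \<Rightarrow> (bit \<times> bit \<Rightarrow>\<^sub>0 'k::field) \<Rightarrow> 'k"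
  where "H22_char p = H2_char (fst p) \<odot> H2_char (snd p)"

lemma H22_char_tens: "H22_char p (u \<otimes> v) = H2_char (fst p) u * H2_char (snd p) v"
  by (simp add: H22_char_def tform_tens linear_form_H2_char)

lemma linear_form_H22_char: "linear_form (H22_char p)"
  by (simp add: H22_char_def)

lemma H22_mul: "mul H22 = (*)" "unt H22 = 1"
  using tensor_monoid_algebra[of "H2 :: (bit, 'k::field) qha" "H2 :: (bit, 'k) qha"]
  by (simp_all add: H22_def tensor_qha_def H2_def kC2_def)

lemma gen_bas: "gen_x = bas (0, 1)" "gen_y = bas (1, 0)"
  unfolding gen_x_def gen_y_def gen_g_def H2_def kC2_def
  by (simp_all flip: single_one del: single_one)

lemma H22_char_gen [simp]:
  "H22_char p gen_x = sign (snd p)" "H22_char p gen_y = sign (fst p)"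
  by (simp_all add: gen_bas H22_char_def H2_char_1)

text \<open>\<open>p_minus\<close> of \<open>gen_x\<close> is the indicator of
  \<open>snd p = 1\<close>, that of \<open>gen_y\<close> the indicator of \<open>fst p = 1\<close>.
  The three terms subtracted in \<open>F_elt w\<close> have disjoint supports, with resulting values
  \<open>1 - w = d\<close> once and \<open>1 - 2 = -1\<close> twice.\<close>

definition F_val :: "'k::field \<Rightarrow> bit \<times> bit \<Rightarrow> bit \<times> bit \<Rightarrow> 'k" where
  "F_val d p q = (if snd p = 1 \<and> fst q = 1 then d
     else if fst p = 1 \<and> snd q = 1 \<and> snd p \<noteq> fst q then -1 else 1)"

text \<open>At \<open>(1, 1)\<close> the last two terms of \<open>U_elt w'\<close> add up to
  \<open>-1 + w' = d\<close>.\<close>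

definition U_val :: "'k::field \<Rightarrow> bit \<times> bit \<Rightarrow> 'k"
  where "U_val d p = (if p = (1, 1) then d else 1)"

context
  assumes two: "(2 :: 'k::field) \<noteq> 0"
begin

text \<open>The two characters see the sum and the difference of the coefficients, which determine
  them since 2 is invertible.\<close>

lemma separating_chars_kC2: "separating_chars (kC2 :: (bit, 'k) alg) H2_char"
  unfolding separating_chars_def
proof (intro conjI allI impI)
  show "alg_char (kC2 :: (bit, 'k) alg) (H2_char j)" for j
    by (simp add: alg_char_def kC2_def linear_form_H2_char H2_char_times H2_char_1)
  fix u v :: "bit \<Rightarrow>\<^sub>0 'k"
  assume eq: "\<forall>j. H2_char j u = H2_char j v"
  let ?l = poly_mapping.lookup
  have "?l u 0 + ?l u 1 = ?l v 0 + ?l v 1" "?l u 0 - ?l u 1 = ?l v 0 - ?l v 1"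
    using eq[rule_format, of 0] eq[rule_format, of 1] by (simp_all add: H2_char_lookup)
  then have "2 * ?l u 0 = 2 * ?l v 0" "2 * ?l u 1 = 2 * ?l v 1"
    by algebra+
  then have "?l u 0 = ?l v 0" "?l u 1 = ?l v 1"
    using two by simp_all
  then show "u = v"
    by (metis bit_poly_mapping_expand)
qed

text \<open>\<open>p_minus\<close> of the generator is the indicator of the nontrivial character, so
  the reassociator is -1 exactly at \<open>(1, 1, 1)\<close>.\<close>

lemma function_qha_H2:
  "function_qha (H2 :: (bit, 'k) qha) H2_char (\<lambda>j k l. sign (j * k * l)) sign (\<lambda>j. 1)"
proof
  note char = alg_charD[OF separating_charsD(1)[OF separating_chars_kC2]]
  show "separating_chars (H2 :: (bit, 'k) qha) H2_char"
    using separating_chars_kC2 by (simp add: separating_chars_def alg_char_def H2_def)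
  fix j k l :: bit and h :: "bit \<Rightarrow>\<^sub>0 'k"
  have lin: "linear_form (\<lambda>h :: bit \<Rightarrow>\<^sub>0 'k. (H2_char j \<odot> H2_char k) (comult H2 h))"
    by (rule linear_form_comp[OF linear_form_tform]) (simp add: H2_def lin_lin_ext)
  show "(H2_char j \<odot> H2_char k) (comult H2 h) = H2_char (j + k) h"
  proof (induction h rule: bas_induct)
    case (bas s)
    show ?case by (simp add: H2_def distrib_right sign_add)
  qed (simp_all add: linear_form_simps[OF linear_form_H2_char] linear_form_simps[OF lin])
  have "alg_char (alg3 (kC2 :: (bit, 'k) alg)) (H2_char j \<odot> H2_char k \<odot> H2_char l)"
    by (intro alg_char_tform separating_charsD(1)[OF separating_chars_kC2])
  then show "(H2_char j \<odot> H2_char k \<odot> H2_char l) (reassoc (H2 :: (bit, 'k) qha)) = sign (j * k * l)"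
    using two
    by (cases j; cases k; cases l)
      (simp_all add: H2_def linear_form_simps[OF linear_form_tform] tform_tens alg_charD(3)
        linear_form_H2_char p_minus_def gen_g_def linear_form_simps[OF linear_form_H2_char] char)
  show "H2_char j (bet (H2 :: (bit, 'k) qha)) = 1"
    by (simp add: H2_def kC2_def H2_char_1)
  show "counit H2 h = H2_char 0 h"
    by (simp add: H2_def H2_char_def)
qed (simp_all add: H2_def gen_g_def)

lemma function_qha_H22: "function_qha (H22 :: (bit \<times> bit, 'k) qha) H22_char
    (\<lambda>p q r. sign (fst p * fst q * fst r) * sign (snd p * snd q * snd r))
    (\<lambda>p. sign (fst p) * sign (snd p)) (\<lambda>_. 1)"
  using function_qha_tensor[OF function_qha_H2 function_qha_H2]
  by (simp add: H22_char_def[abs_def] flip: H22_def)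

lemma H22_char_U_elt: "H22_char p (U_elt w' :: _ \<Rightarrow>\<^sub>0 'k) = U_val (w' - 1) p"
proof -
  obtain s t where "p = (s, t)" by (cases p)
  then show ?thesis
    using two
    by (cases s; cases t)
      (simp_all add: U_elt_def Let_def U_val_def H22_char_tens linear_form_simps[OF linear_form_H22_char]
        p_plus_def p_minus_def linear_form_simps[OF linear_form_H2_char] H2_def kC2_def H2_char_1
        gen_g_def)
qed

lemma H22_char_F_elt: "(H22_char p \<odot> H22_char q) (F_elt w :: _ \<Rightarrow>\<^sub>0 'k) = F_val (1 - w) p q"
proof -
  interpret function_qha "H22 :: (bit \<times> bit, 'k) qha" H22_char
      "\<lambda>p q r. sign (fst p * fst q * fst r) * sign (snd p * snd q * snd r)"
      "\<lambda>p. sign (fst p) * sign (snd p)" "\<lambda>_. 1"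
    by (rule function_qha_H22)
  obtain s t where p: "p = (s, t)" by (cases p)
  obtain s' t' where q: "q = (s', t')" by (cases q)
  show ?thesis
    using two unfolding p q
    by (cases s; cases t; cases s'; cases t')
      (simp_all add: F_elt_def Let_def F_val_def tform_tens p_plus_def p_minus_def char_simps)
qed

end
section \<open>The algebra with two generators and relations \<open>X\<^sup>2 = 1\<close>, \<open>Y\<^sup>2 = X\<close>\<close>

lemma is_algD:
  assumes "is_alg A"
  shows "u \<cdot>\<^bsub>A\<^esub> (v + v') = u \<cdot>\<^bsub>A\<^esub> v + u \<cdot>\<^bsub>A\<^esub> v'" "(u + u') \<cdot>\<^bsub>A\<^esub> v = u \<cdot>\<^bsub>A\<^esub> v + u' \<cdot>\<^bsub>A\<^esub> v"
    "u \<cdot>\<^bsub>A\<^esub> scale c v = scale c (u \<cdot>\<^bsub>A\<^esub> v)" "scale c u \<cdot>\<^bsub>A\<^esub> v = scale c (u \<cdot>\<^bsub>A\<^esub> v)"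
    "u \<cdot>\<^bsub>A\<^esub> v \<cdot>\<^bsub>A\<^esub> z = u \<cdot>\<^bsub>A\<^esub> (v \<cdot>\<^bsub>A\<^esub> z)" "unt A \<cdot>\<^bsub>A\<^esub> u = u" "u \<cdot>\<^bsub>A\<^esub> unt A = u"
    "u \<cdot>\<^bsub>A\<^esub> 0 = 0" "0 \<cdot>\<^bsub>A\<^esub> v = 0"
proof -
  show add: "u \<cdot>\<^bsub>A\<^esub> (v + v') = u \<cdot>\<^bsub>A\<^esub> v + u \<cdot>\<^bsub>A\<^esub> v'" "(u + u') \<cdot>\<^bsub>A\<^esub> v = u \<cdot>\<^bsub>A\<^esub> v + u' \<cdot>\<^bsub>A\<^esub> v"
    for u u' v v' using assms by (simp_all add: is_alg_def lin_iff)
  show "u \<cdot>\<^bsub>A\<^esub> 0 = 0" "0 \<cdot>\<^bsub>A\<^esub> v = 0"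
    using add(1)[of u 0 0] add(2)[of 0 0 v] by simp_all
qed (use assms in \<open>simp_all add: is_alg_def lin_iff\<close>)

lemma alg_homD:
  assumes "alg_hom A B f"
  shows "f (u + v) = f u + f v" "f (scale c u) = scale c (f u)"
    "f (u \<cdot>\<^bsub>A\<^esub> v) = f u \<cdot>\<^bsub>B\<^esub> f v" "f (unt A) = unt B"
  using assms by (simp_all add: alg_hom_def lin_iff)

lemma alg_power_simps:
  "alg_power A u 0 = unt A" "alg_power A u (Suc n) = u \<cdot>\<^bsub>A\<^esub> alg_power A u n"
  by (simp_all add: alg_power_def)

lemma alg_power_add:
  assumes "is_alg A"
  shows "alg_power A u (m + n) = alg_power A u m \<cdot>\<^bsub>A\<^esub> alg_power A u n"
  by (induction m) (simp_all add: alg_power_simps is_algD[OF assms])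

lemma eval2_add: "eval2 A X Y (p + q) = eval2 A X Y p + eval2 A X Y q"
  and eval2_scale: "eval2 A X Y (scale c p) = scale c (eval2 A X Y p)"
  and eval2_bas: "eval2 A X Y (bas (m, n)) = alg_power A X m \<cdot>\<^bsub>A\<^esub> alg_power A Y n"
  and eval2_zero: "eval2 A X Y 0 = 0"
  by (simp_all add: eval2_def lin_ext_add lin_ext_scale)

lemma eval2_diff: "eval2 A X Y (p - q) = eval2 A X Y p - eval2 A X Y q"
  using eval2_add[of A X Y "p - q" q] by simp

lemma eval2_times:
  assumes A: "is_alg A" and comm: "\<And>u v. u \<cdot>\<^bsub>A\<^esub> v = v \<cdot>\<^bsub>A\<^esub> u"
  shows "eval2 A X Y (p * q) = eval2 A X Y p \<cdot>\<^bsub>A\<^esub> eval2 A X Y q"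
proof (induction p rule: bas_induct)
  case (bas s)
  show ?case
  proof (induction q rule: bas_induct)
    case (bas t)
    obtain m n m' n' where st: "s = (m, n)" "t = (m', n')" by (cases s; cases t)
    have "bas s * bas t = (bas (m + m', n + n') :: nat \<times> nat \<Rightarrow>\<^sub>0 'b)"
      by (simp add: st bas_mult_bas)
    then show ?case
      unfolding st eval2_bas alg_power_add[OF A]
      by (simp add: eval2_bas alg_power_add[OF A]) (metis comm is_algD(5)[OF A])
  qed (simp_all add: eval2_add eval2_scale eval2_zero is_algD[OF A] distrib_left scale_mult_right)
qed (simp_all add: eval2_add eval2_scale eval2_zero is_algD[OF A] distrib_right scale_mult_left)

lemma eval2_generators:
  assumes A: "is_alg A"
  shows "eval2 A X Y 1 = unt A" "eval2 A X Y (bas (1, 0)) = X" "eval2 A X Y (bas (0, 1)) = Y"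
    "eval2 A X Y (bas (2, 0)) = X \<cdot>\<^bsub>A\<^esub> X" "eval2 A X Y (bas (0, 2)) = Y \<cdot>\<^bsub>A\<^esub> Y"
proof -
  have "bas (0, 0) = (1 :: nat \<times> nat \<Rightarrow>\<^sub>0 'b)"
    by (simp flip: zero_prod_def)
  then show "eval2 A X Y 1 = unt A"
    using eval2_bas[of A X Y 0 0] by (simp add: alg_power_simps is_algD[OF A])
qed (simp_all add: eval2_bas alg_power_simps is_algD[OF A] numeral_2_eq_2)

context
  fixes A :: "('a, 'k::field, 'm) alg_scheme" and X Y
  assumes presented: "DH2_presented A X Y"
begin

lemma DH2_presentedD: "is_alg A" "u \<cdot>\<^bsub>A\<^esub> v = v \<cdot>\<^bsub>A\<^esub> u" "surj (eval2 A X Y)"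
  using presented by (auto simp: DH2_presented_def)

lemma eval2_eq_0_iff: "eval2 A X Y p = 0 \<longleftrightarrow>
    (\<exists>q r. p = q * (bas (2, 0) - 1) + r * (bas (0, 2) - bas (1, 0)))"
  using presented by (simp add: DH2_presented_def)

lemma DH2_relations: "X \<cdot>\<^bsub>A\<^esub> X = unt A" "Y \<cdot>\<^bsub>A\<^esub> Y = X"
proof -
  have "eval2 A X Y (bas (2, 0) - 1) = 0"
    by (subst eval2_eq_0_iff, intro exI[of _ 1] exI[of _ 0]) simp
  moreover have "eval2 A X Y (bas (0, 2) - bas (1, 0)) = 0"
    by (subst eval2_eq_0_iff, intro exI[of _ 0] exI[of _ 1]) simp
  ultimately show "X \<cdot>\<^bsub>A\<^esub> X = unt A" "Y \<cdot>\<^bsub>A\<^esub> Y = X"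
    by (simp_all add: eval2_diff eval2_generators[OF DH2_presentedD(1)] del: One_nat_def)
qed

text \<open>The four listed elements are closed under multiplication by \<open>X\<close> and
  \<open>Y\<close>, hence contain all monomials and span the algebra.\<close>

lemma DH2_induct:
  assumes P: "\<And>u v. P u \<Longrightarrow> P v \<Longrightarrow> P (u + v)" "\<And>c u. P u \<Longrightarrow> P (scale c u)"
    "P (unt A)" "P X" "P Y" "P (X \<cdot>\<^bsub>A\<^esub> Y)"
  shows "P v"
proof -
  let ?B = "{unt A, X, Y, X \<cdot>\<^bsub>A\<^esub> Y}"
  note alg = is_algD[OF DH2_presentedD(1)]
  have X: "X \<cdot>\<^bsub>A\<^esub> u \<in> ?B" if "u \<in> ?B" for u
    using that by (auto simp: alg DH2_relations simp flip: alg(5))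
  have Y: "Y \<cdot>\<^bsub>A\<^esub> u \<in> ?B" if "u \<in> ?B" for u
  proof -
    have "Y \<cdot>\<^bsub>A\<^esub> X = X \<cdot>\<^bsub>A\<^esub> Y" by (rule DH2_presentedD(2))
    moreover have "Y \<cdot>\<^bsub>A\<^esub> (X \<cdot>\<^bsub>A\<^esub> Y) = unt A"
      by (metis DH2_presentedD(2) DH2_relations alg(5))
    ultimately show ?thesis using that by (auto simp: alg DH2_relations)
  qed
  have Y_power: "alg_power A Y n \<in> ?B" for n
    by (induction n) (simp add: alg_power_simps, unfold alg_power_simps, rule Y)
  have "alg_power A X m \<cdot>\<^bsub>A\<^esub> alg_power A Y n \<in> ?B" for m n
  proof (induction m)
    case 0
    show ?case unfolding alg_power_simps alg by (rule Y_power)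
  next
    case (Suc m)
    then show ?case unfolding alg_power_simps alg by (rule X)
  qed
  then have bas: "P (eval2 A X Y (bas (m, n)))" for m n
    unfolding eval2_bas using P(3-) by (metis empty_iff insert_iff)
  have "P (eval2 A X Y p)" for p
  proof (induction p rule: bas_induct)
    case zero
    \<comment> \<open>Zero is reached as a multiple of the unit.\<close>
    have "scale 0 (unt A) = 0" by (rule poly_mapping_eqI) simp
    then show ?case using P(2)[OF P(3), of 0] by (simp add: eval2_zero)
  qed (auto simp: eval2_add eval2_scale intro: P bas)
  then show ?thesis
    using DH2_presentedD(3) by (metis surjD)
qed

lemma DH2_hom_unique:
  assumes f: "alg_hom A B f" and g: "alg_hom A B g" and "f X = g X" "f Y = g Y"
  shows "f = g"
proof
  show "f u = g u" for u
    by (induction u rule: DH2_induct) (simp_all add: alg_homD[OF f] alg_homD[OF g] assms(3,4))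
qed

text \<open>Universal property of the presentation: evaluation at \<open>(x, y)\<close> kills the
  generators of the ideal, so it factors through \<open>A\<close>.\<close>

lemma DH2_hom_exists:
  assumes B: "is_alg B" and comm: "\<And>u v. u \<cdot>\<^bsub>B\<^esub> v = v \<cdot>\<^bsub>B\<^esub> u"
    and rel: "x \<cdot>\<^bsub>B\<^esub> x = unt B" "y \<cdot>\<^bsub>B\<^esub> y = x"
  shows "\<exists>f. alg_hom A B f \<and> f X = x \<and> f Y = y"
proof -
  let ?ev = "eval2 A X Y" and ?ev' = "eval2 B x y"
  note A = DH2_presentedD(1)
  \<comment> \<open>\<open>inv ?ev\<close> chooses some preimage polynomial; \<open>kernel\<close>
    makes the value independent of the choice.\<close>
  define f where "f u = ?ev' (inv ?ev u)" for u
  have kernel: "?ev' p = 0" if "?ev p = 0" for p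
    using that
    by (auto simp: eval2_eq_0_iff eval2_add eval2_diff eval2_times[OF B comm] eval2_generators[OF B]
        rel is_algD[OF B] simp del: One_nat_def)
  have f: "f (?ev p) = ?ev' p" for p
  proof -
    have "?ev (inv ?ev (?ev p) - p) = 0"
      by (simp add: eval2_diff surj_f_inv_f[OF DH2_presentedD(3)])
    then have "?ev' (inv ?ev (?ev p) - p) = 0"
      by (rule kernel)
    then show ?thesis by (simp add: f_def eval2_diff)
  qed
  have "f (u + v) = f u + f v" "f (scale c u) = scale c (f u)" "f (u \<cdot>\<^bsub>A\<^esub> v) = f u \<cdot>\<^bsub>B\<^esub> f v" for u v c
  proof -
    obtain p q where "u = ?ev p" "v = ?ev q"
      using DH2_presentedD(3) by (metis surjD)
    then show "f (u + v) = f u + f v" "f (scale c u) = scale c (f u)" "f (u \<cdot>\<^bsub>A\<^esub> v) = f u \<cdot>\<^bsub>B\<^esub> f v"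
      by (simp_all add: f flip: eval2_add eval2_scale eval2_times[OF A DH2_presentedD(2)])
        (simp_all add: f eval2_add eval2_scale eval2_times[OF B comm])
  qed
  moreover have "f (unt A) = unt B" "f X = x" "f Y = y"
    using f[of 1] f[of "bas (1, 0)"] f[of "bas (0, 1)"]
    by (simp_all only: eval2_generators[OF A] eval2_generators[OF B])
  ultimately show ?thesis
    by (auto simp: alg_hom_def lin_iff)
qed

end

section \<open>The common data of \<open>D(H(2))\<close> and of the twisted tensor square\<close>

definition parity :: "bit \<times> bit \<Rightarrow> bit"
  where "parity p = fst p + snd p"

lemma parity_add: "parity (p + q) = parity p + parity q"
  by (simp only: parity_def fst_add snd_add ac_simps)

abbreviation DH2_cocycle :: "bit \<times> bit \<Rightarrow> bit \<times> bit \<Rightarrow> bit \<times> bit \<Rightarrow> 'k::field"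
  where "DH2_cocycle p q r \<equiv> sign (parity p * parity q * parity r)"

abbreviation DH2_data :: "(('a, 'k::field) qha) \<Rightarrow> (bit \<times> bit \<Rightarrow> ('a \<Rightarrow>\<^sub>0 'k) \<Rightarrow> 'k) \<Rightarrow> bool"
  where "DH2_data H e \<equiv> function_qha H e DH2_cocycle (\<lambda>p. sign (parity p)) (\<lambda>_. 1)"

lemma DH2_data_quasi_hopf:
  assumes "DH2_data H e"
  shows "quasi_hopf H"
proof -
  interpret function_qha H e DH2_cocycle "\<lambda>p. sign (parity p)" "\<lambda>_. 1" by fact
  have sign_square: "sign s * sign s = (1 :: 'b)" for s
    by (cases s) simp_all
  show ?thesis
  proof (rule quasi_hopf)
    show "alg_invertible (alg3 H) (reassoc H)"
      \<comment> \<open>With values 1 and -1, the reassociator is its own inverse.\<close>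
      by (rule separating_chars_alg_invertible[OF chars3, of _ "reassoc H"])
        (simp add: reassoc sign_square)
  next
    fix p q r s :: "bit \<times> bit"
    show "DH2_cocycle q r s * DH2_cocycle p (q + r) s * DH2_cocycle p q r
        = (DH2_cocycle p q (r + s) * DH2_cocycle (p + q) r s :: 'b)"
      by (cases "parity p"; cases "parity q"; cases "parity r"; cases "parity s")
        (simp_all add: parity_add)
    show "DH2_cocycle p 0 q = (1 :: 'b)"
      by (simp add: parity_def)
    show "DH2_cocycle p (- p) p * (sign (parity p) * 1) = (1 :: 'b)"
      "inverse (DH2_cocycle (- p) p (- p)) * (sign (parity p) * 1) = (1 :: 'b)"
      by (cases "parity p"; simp)+
  qed
qed

text \<open>The values of \<zeta>(Y). For \<open>d * d = -1\<close> they are square roots of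
  \<open>sign (parity p)\<close>, the values of \<zeta>(X).\<close>

definition Y_val :: "'k::field \<Rightarrow> bit \<times> bit \<Rightarrow> 'k" where
  "Y_val d p = (if p = (0, 0) then -1 else if p = (1, 1) then 1 else if snd p = 1 then - d else d)"

definition twisted_H22 :: "'k::field \<Rightarrow> 'k \<Rightarrow> (bit \<times> bit, 'k) qha"
  where "twisted_H22 w w' = change_antip (twist H22 (F_elt w)) (U_elt w')"

text \<open>Below, \<open>d = 1 - \<omega>\<^sub>\<plusminus> = \<omega>\<^sub>\<mp> - 1\<close> is a primitive fourth root of unity, so that the values of
  \<^term>\<open>F_elt w\<close> and \<^term>\<open>U_elt w'\<close> at all characters are fourth roots of unity.\<close>

context
  fixes w w' d :: "'k::field"
  assumes two: "(2 :: 'k) \<noteq> 0"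
    and d: "d * d = -1"
    and w: "w = 1 - d" and w': "w' = 1 + d"
begin

lemma d_simps: "d * (d * z) = - z" "inverse d = - d"
proof -
  show "d * (d * z) = - z" using d by (simp flip: mult.assoc)
  show "inverse d = - d" using d by (intro inverse_unique) simp
qed

lemma four: "(4 :: 'k) \<noteq> 0"
proof -
  have "(2 :: 'k) * 2 \<noteq> 0" using two by (simp only: mult_eq_0_iff simp_thms not_False_eq_True)
  then show ?thesis by simp
qed

section \<open>The twisted tensor square on characters\<close>

lemma chars_U: "H22_char p (U_elt w' :: _ \<Rightarrow>\<^sub>0 'k) = U_val d p"
  by (simp add: H22_char_U_elt[OF two] w')

lemma chars_F: "(H22_char p \<odot> H22_char q) (F_elt w :: _ \<Rightarrow>\<^sub>0 'k) = F_val d p q"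
  by (simp add: H22_char_F_elt[OF two] w)

interpretation H22: function_qha "H22 :: (bit \<times> bit, 'k) qha" H22_char
    "\<lambda>p q r. sign (fst p * fst q * fst r) * sign (snd p * snd q * snd r)"
    "\<lambda>p. sign (fst p) * sign (snd p)" "\<lambda>_. 1"
  by (rule function_qha_H22[OF two])

lemma invertible_U: "alg_invertible (H22 :: (bit \<times> bit, 'k) qha) (U_elt w')"
proof (rule separating_chars_alg_invertible[OF H22.chars])
  let ?U = "U_elt w'"
  \<comment> \<open>Cubing inverts fourth roots of unity; the cube serves as inverse again for
    \<open>F_elt w\<close> in \<open>twist_F\<close>.\<close>
  show "H22_char p ?U * H22_char p (?U \<cdot>\<^bsub>H22\<^esub> (?U \<cdot>\<^bsub>H22\<^esub> ?U)) = 1" for p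
    by (simp add: H22.char_simps chars_U U_val_def d d_simps)
qed

lemma twist_F: "is_twist (H22 :: (bit \<times> bit, 'k) qha) (F_elt w)"
  unfolding is_twist_def
proof (intro conjI)
  let ?F = "F_elt w"
  show "alg_invertible (alg2 H22) ?F"
  proof (rule separating_chars_alg_invertible[OF H22.chars2])
    show "(H22_char (fst p) \<odot> H22_char (snd p)) ?F * (H22_char (fst p) \<odot> H22_char (snd p))
        (?F \<cdot>\<^bsub>alg2 H22\<^esub> (?F \<cdot>\<^bsub>alg2 H22\<^esub> ?F)) = 1" for p
      by (simp add: H22.char_simps chars_F F_val_def d d_simps)
  qed
  show "contract_left (counit H22) ?F = unt H22" "contract_right (counit H22) ?F = unt H22"
    by (rule H22.eqI, simp add: tform_contract_left[OF H22.lin_char]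
        tform_contract_right[OF H22.lin_char] H22.counit_eq chars_F F_val_def H22.char_simps)+
qed

text \<open>The constant terms cancel because \<open>w + w' = 2\<close>.\<close>

lemma zeta_Y:
  "- unt H22 + scale w (p_minus H22 gen_x) + scale w' (p_minus H22 gen_y)
     = (scale (- (1/2)) (scale w gen_x + scale w' gen_y) :: _ \<Rightarrow>\<^sub>0 'k)"
proof (rule H22.eqI)
  fix p :: "bit \<times> bit"
  have minus: "H22_char p (- u) = - H22_char p u" for u :: "_ \<Rightarrow>\<^sub>0 'k"
    using linear_form_diff[OF H22.lin_char, of p 0 u] by (simp add: H22.char_simps)
  show "H22_char p (- unt H22 + scale w (p_minus H22 gen_x) + scale w' (p_minus H22 gen_y))
     = H22_char p (scale (- (1/2)) (scale w gen_x + scale w' gen_y) :: _ \<Rightarrow>\<^sub>0 'k)"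
    using two four by (simp add: H22.char_simps minus p_minus_def w w' field_simps)
qed

lemma twisted_H22_mul: "mul (twisted_H22 w w') = mul H22" "unt (twisted_H22 w w') = unt H22"
  by (simp_all add: twisted_H22_def change_antip_def twist_def Let_def)

text \<open>The coboundary of \<open>F_val d\<close> carries the product of the two sign cocycles to
  the sign cocycle of the parity; this is checked on all 64 triples of points.\<close>

lemma DH2_data_twisted_H22: "DH2_data (twisted_H22 w w') H22_char"
proof -
  have "alg_invertible (alg2 H22) (F_elt w)"
    using twist_F by (simp add: is_twist_def)
  note twist = H22.function_qha_twist[OF this chars_F]
  have "alg_invertible (twist H22 (F_elt w)) (U_elt w')"
    using invertible_U by (simp add: alg_invertible_def twist_def Let_def)
  note T = function_qha.function_qha_change_antip[OF twist this chars_U, folded twisted_H22_def]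
  have "F_val d q r * F_val d p (q + r) * (sign (fst p * fst q * fst r) * sign (snd p * snd q * snd r))
      * inverse (F_val d (p + q) r) * inverse (F_val d p q) = DH2_cocycle p q r" for p q r
  proof -
    obtain s t s' t' s'' t'' where "p = (s, t)" "q = (s', t')" "r = (s'', t'')"
      by (cases p; cases q; cases r)
    then show ?thesis
      by (cases s; cases t; cases s'; cases t'; cases s''; cases t'')
        (simp_all add: F_val_def parity_def d d_simps)
  qed
  \<comment> \<open>Since \<open>- p = p\<close> and \<open>F_val d p p = U_val d p\<close>, the
    change of antipode undoes exactly what the twist does to \<open>alph\<close> and
    \<open>bet\<close>.\<close>
  moreover have "U_val d p * (inverse (F_val d (- p) p) * (sign (fst p) * sign (snd p))) = sign (parity p)"
      "F_val d p (- p) * 1 * inverse (U_val d p) = 1" for p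
    by (cases p; cases "fst p"; cases "snd p";
        simp add: F_val_def U_val_def parity_def d d_simps)+
  ultimately show ?thesis
    using T by simp
qed

lemma char_zeta_Y: "H22_char p (scale (- (1/2)) (scale w gen_x + scale w' gen_y)) = Y_val d p"
  using two
  by (cases p; cases "fst p"; cases "snd p"; simp add: H22.char_simps Y_val_def w w' field_simps)

section \<open>Bijectivity and compatibility of \<zeta>\<close>

context
  fixes D :: "('b, 'k) qha" and X Y :: "'b \<Rightarrow>\<^sub>0 'k"
    and \<zeta> :: "('b \<Rightarrow>\<^sub>0 'k) \<Rightarrow> (bit \<times> bit \<Rightarrow>\<^sub>0 'k)"
  assumes double: "is_DH2 D X Y"
    and hom: "alg_hom D (twisted_H22 w w') \<zeta>"
    and zeta: "\<zeta> X = gen_x \<cdot>\<^bsub>H22\<^esub> gen_y" "\<zeta> Y = scale (- (1/2)) (scale w gen_x + scale w' gen_y)"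
begin

lemma double_simps:
  "alg_hom D (alg2 D) (comult D)" "comult D X = X \<otimes> X"
  "comult D Y = scale (- (1/2)) (Y \<otimes> Y + (X \<cdot>\<^bsub>D\<^esub> Y) \<otimes> Y + Y \<otimes> (X \<cdot>\<^bsub>D\<^esub> Y)
     - (X \<cdot>\<^bsub>D\<^esub> Y) \<otimes> (X \<cdot>\<^bsub>D\<^esub> Y))"
  "alg_char D (counit D)" "counit D X = 1" "counit D Y = -1"
  "reassoc D = unt (alg3 D) - scale 2 (p_minus D X \<otimes> p_minus D X \<otimes> p_minus D X)"
  "antip D = id" "alph D = X" "bet D = unt D"
  using double by (simp_all add: is_DH2_def Let_def)

lemma presented: "DH2_presented D X Y"
  using double by (simp add: is_DH2_def Let_def)

text \<open>Multiplication by \<open>xy\<close> exchanges \<open>x\<close> and \<open>y\<close>, as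
  both square to 1.\<close>

lemma zeta_XY: "\<zeta> (X \<cdot>\<^bsub>D\<^esub> Y) = scale (- (1/2)) (scale w gen_y + scale w' gen_x)"
proof (rule H22.eqI)
  have "H22_char p (\<zeta> (X \<cdot>\<^bsub>D\<^esub> Y)) = H22_char p (\<zeta> X) * H22_char p (\<zeta> Y)" for p
    by (simp add: alg_homD[OF hom] twisted_H22_mul H22.char_simps)
  then show "H22_char p (\<zeta> (X \<cdot>\<^bsub>D\<^esub> Y)) = H22_char p (scale (- (1/2)) (scale w gen_y + scale w' gen_x))" for p
    unfolding zeta by (cases p; cases "fst p"; cases "snd p"; simp add: H22.char_simps)
qed

text \<open>The linear system \<open>Y = - \<omega>\<^sub>\<plusminus>/2 x - \<omega>\<^sub>\<mp>/2 y\<close>, \<open>XY = - \<omega>\<^sub>\<mp>/2 x - \<omega>\<^sub>\<plusminus>/2 y\<close> is solved for \<open>x\<close> and \<open>y\<close>;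
  its determinant is \<open>(\<omega>\<^sub>\<plusminus>\<^sup>2 - \<omega>\<^sub>\<mp>\<^sup>2)/4 = - d\<close>.\<close>

lemma solve_xy:
  fixes u v :: "'a \<Rightarrow>\<^sub>0 'k"
  shows "scale (- (1/2)) (scale w (scale (- (d/2)) (scale w u - scale w' v))
      + scale w' (scale (- (d/2)) (scale w v - scale w' u))) = u"
    and "scale (- (d/2)) (scale w (scale (- (1/2)) (scale w u + scale w' v))
      - scale w' (scale (- (1/2)) (scale w v + scale w' u))) = u"
proof -
  have "w * w - w' * w' = - (4 * d)"
    by (simp add: w w' algebra_simps)
  then have det: "(d / 4) * (w * w - w' * w') = 1"
    using four d by simp
  have "- (1/2) * (w * (- (d/2) * (w * s - w' * t)) + w' * (- (d/2) * (w * t - w' * s)))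
      = (d / 4) * (w * w - w' * w') * s"
    "- (d/2) * (w * (- (1/2) * (w * s + w' * t)) - w' * (- (1/2) * (w * t + w' * s)))
      = (d / 4) * (w * w - w' * w') * s" for s t
    by (simp_all add: algebra_simps)
  then show "scale (- (1/2)) (scale w (scale (- (d/2)) (scale w u - scale w' v))
      + scale w' (scale (- (d/2)) (scale w v - scale w' u))) = u"
    "scale (- (d/2)) (scale w (scale (- (1/2)) (scale w u + scale w' v))
      - scale w' (scale (- (1/2)) (scale w v + scale w' u))) = u"
    unfolding det by (auto intro!: poly_mapping_eqI simp only: lookup_add lookup_minus lookup_scale mult_1)
qed

text \<open>A linear inverse suffices: one composite is checked on the spanning elements 1, X, Y,
  XY, the other on the basis of group elements.\<close>

lemma bij_zeta: "bij \<zeta>"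
proof (rule o_bij)
  \<comment> \<open>Preimages of \<open>gen_x\<close> and \<open>gen_y\<close>, read off from
    \<open>solve_xy\<close>; the basis elements \<open>(1, 0)\<close> and \<open>(0, 1)\<close> are
    \<open>gen_y\<close> and \<open>gen_x\<close>.\<close>
  define x y where "x = scale (- (d/2)) (scale w Y - scale w' (X \<cdot>\<^bsub>D\<^esub> Y))"
    and "y = scale (- (d/2)) (scale w (X \<cdot>\<^bsub>D\<^esub> Y) - scale w' Y)"
  define \<eta> :: "(bit \<times> bit \<Rightarrow>\<^sub>0 'k) \<Rightarrow> ('b \<Rightarrow>\<^sub>0 'k)"
    where "\<eta> = lin_ext (\<lambda>s. if s = (0, 0) then unt D else if s = (1, 0) then y
      else if s = (0, 1) then x else X)"
  have \<eta>_zero: "\<eta> 0 = 0"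
    by (simp add: \<eta>_def)
  have \<eta>_hom: "\<eta> (u + v) = \<eta> u + \<eta> v" "\<eta> (scale c u) = scale c (\<eta> u)" for u v c
    by (simp_all add: \<eta>_def lin_ext_add lin_ext_scale)
  have units: "unt (H22 :: (bit \<times> bit, 'k) qha) = bas (0, 0)" "gen_x \<cdot>\<^bsub>H22\<^esub> gen_y = (bas (1, 1) :: _ \<Rightarrow>\<^sub>0 'k)"
    by (simp_all add: H22_mul gen_bas bas_mult_bas flip: zero_prod_def)
  have \<eta>: "\<eta> (unt H22) = unt D" "\<eta> (gen_x \<cdot>\<^bsub>H22\<^esub> gen_y) = X" "\<eta> gen_x = x" "\<eta> gen_y = y"
    unfolding units unfolding gen_bas by (simp_all add: \<eta>_def del: single_one)
  have "\<eta> (\<zeta> u) = u" for u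
  proof (induction u rule: DH2_induct[OF presented, case_names add scale unit X Y XY])
    case Y
    show ?case unfolding zeta \<eta>_hom \<eta> x_def y_def by (rule solve_xy(1))
  next
    case XY
    show ?case unfolding zeta_XY \<eta>_hom \<eta> x_def y_def by (rule solve_xy(1))
  qed (simp_all add: alg_homD[OF hom] \<eta>_hom \<eta> zeta twisted_H22_mul)
  then show "\<eta> \<circ> \<zeta> = id" by auto
  have \<zeta>_diff: "\<zeta> (u - v) = \<zeta> u - \<zeta> v" for u v
    using alg_homD(1)[OF hom, of "u - v" v] by simp
  have "\<zeta> x = gen_x" "\<zeta> y = gen_y"
    unfolding x_def y_def alg_homD(2)[OF hom] \<zeta>_diff zeta zeta_XY
    by (simp_all only: solve_xy(2))
  then have "\<zeta> (\<eta> (bas s)) = bas s" for s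
    by (cases s; cases "fst s"; cases "snd s")
      (auto simp: \<eta>_def gen_bas alg_homD[OF hom] twisted_H22_mul units(1) zeta H22_mul(1) bas_mult_bas
        simp del: single_one)
  then have "\<zeta> (\<eta> u) = u" for u
    by (induction u rule: bas_induct)
      (use \<zeta>_diff[of 0 0] \<eta>_zero in \<open>simp_all add: alg_homD[OF hom] \<eta>_hom\<close>)
  then show "\<zeta> \<circ> \<eta> = id" by auto
qed

lemma zeta_char: "alg_char D (\<lambda>u. H22_char p (\<zeta> u))"
  by (rule alg_char_comp[OF _ hom]) (rule function_qha.char[OF DH2_data_twisted_H22])

lemma chars_zeta: "H22_char p (\<zeta> X) = sign (parity p)" "H22_char p (\<zeta> Y) = Y_val d p"
  by (simp_all add: zeta(2) char_zeta_Y)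
    (simp only: zeta(1) H22.char_simps(1) H22_char_gen parity_def sign_add mult.commute)

text \<open>The characters of the target, pulled back along \<zeta>, separate points because \<zeta>
  is injective. The structure maps then only need checking on X and Y.\<close>

lemma DH2_data_D: "DH2_data D (\<lambda>p u. H22_char p (\<zeta> u))"
proof
  let ?e = "\<lambda>p u. H22_char p (\<zeta> u)"
  note e = alg_charD[OF zeta_char]
  show "separating_chars D ?e"
    unfolding separating_chars_def
    using zeta_char by (blast intro: injD[OF bij_is_inj[OF bij_zeta]] H22.eqI)
  show "(?e p \<odot> ?e q) (comult D h) = ?e (p + q) h" for p q h
  proof -
    note e2 = alg_charD[OF alg_char_tform[OF zeta_char zeta_char]]
    \<comment> \<open>On characters the coproduct formula says that \<open>Y_val d (p + q)\<close>
      is \<open>- sign (parity p * parity q) * Y_val d p * Y_val d q\<close>.\<close>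
    have Y: "(?e p \<odot> ?e q) (comult D Y) = ?e (p + q) Y"
      using two
      by (cases p; cases "fst p"; cases "snd p"; cases q; cases "fst q"; cases "snd q";
        simp add: double_simps linear_form_simps[OF linear_form_tform] tform_tens[OF e(1) e(1)] e chars_zeta
          Y_val_def parity_def d)
    have X: "(?e p \<odot> ?e q) (comult D X) = ?e (p + q) X"
      by (simp only: double_simps tform_tens[OF e(1) e(1)] chars_zeta parity_add sign_add)
    show ?thesis
      by (induction h rule: DH2_induct[OF presented])
        (simp_all add: alg_homD[OF double_simps(1)] linear_form_simps[OF linear_form_tform]
          linear_form_simps[OF e(1)] X Y e e2)
  qed
  show "counit D h = ?e 0 h" for h
    by (induction h rule: DH2_induct[OF presented])
      (simp_all add: linear_form_simps[OF alg_charD(1)[OF double_simps(4)]] linear_form_simps[OF e(1)]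
        alg_charD(2,3)[OF double_simps(4)] e(2,3) chars_zeta double_simps(5,6) parity_def Y_val_def
        flip: zero_prod_def)
  show "(?e p \<odot> ?e q \<odot> ?e r) (reassoc D) = DH2_cocycle p q r" for p q r
    using two alg_charD(3)[OF alg_char_tform[OF zeta_char alg_char_tform[OF zeta_char zeta_char]]]
    by (cases "parity p"; cases "parity q"; cases "parity r";
      simp add: double_simps linear_form_simps[OF linear_form_tform] tform_tens[OF e(1) linear_form_tform]
        tform_tens[OF e(1) e(1)] linear_form_simps[OF e(1)] p_minus_def e chars_zeta)
qed (simp_all add: double_simps chars_zeta alg_charD(3)[OF zeta_char])

lemma quasi_hopf_iso_zeta: "quasi_hopf_iso D (twisted_H22 w w') \<zeta>"
  \<comment> \<open>\<open>refl\<close> supplies the matching of evaluations, since those of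
    \<open>D\<close> are pullbacks along \<zeta>.\<close>
  using DH2_data_D DH2_data_twisted_H22 refl bij_zeta DH2_data_quasi_hopf[OF DH2_data_D]
    DH2_data_quasi_hopf[OF DH2_data_twisted_H22]
  by (rule function_qha_iso)

end

text \<open>The universal property applies once the images satisfy both relations, which is checked
  on characters.\<close>

lemma zeta_exists:
  fixes D :: "('b, 'k) qha"
  assumes "is_DH2 D X Y"
  shows "\<exists>\<zeta>. alg_hom D (twisted_H22 w w') \<zeta> \<and> \<zeta> X = gen_x \<cdot>\<^bsub>H22\<^esub> gen_y
    \<and> \<zeta> Y = scale (- (1/2)) (scale w gen_x + scale w' gen_y)"
proof (rule DH2_hom_exists)
  interpret T: function_qha "twisted_H22 w w'" H22_char DH2_cocycle "\<lambda>p. sign (parity p)" "\<lambda>_. 1"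
    by (rule DH2_data_twisted_H22)
  show "DH2_presented D X Y"
    using assms by (simp add: is_DH2_def Let_def)
  show "is_alg (twisted_H22 w w')"
    by (rule separating_chars_is_alg[OF T.chars])
  show "u \<cdot>\<^bsub>twisted_H22 w w'\<^esub> v = v \<cdot>\<^bsub>twisted_H22 w w'\<^esub> u" for u v
    by (rule separating_chars_commute[OF T.chars])
  let ?x = "gen_x \<cdot>\<^bsub>H22\<^esub> gen_y" and ?y = "scale (- (1/2)) (scale w gen_x + scale w' gen_y)"
  show "?x \<cdot>\<^bsub>twisted_H22 w w'\<^esub> ?x = unt (twisted_H22 w w')"
  proof (rule T.eqI)
    show "H22_char p (?x \<cdot>\<^bsub>twisted_H22 w w'\<^esub> ?x) = H22_char p (unt (twisted_H22 w w'))" for p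
      by (cases p; cases "fst p"; cases "snd p"; simp add: T.char_simps H22.char_simps)
  qed
  show "?y \<cdot>\<^bsub>twisted_H22 w w'\<^esub> ?y = ?x"
  proof (rule T.eqI)
    show "H22_char p (?y \<cdot>\<^bsub>twisted_H22 w w'\<^esub> ?y) = H22_char p ?x" for p
      unfolding T.char_simps(1) H22.char_simps(1) char_zeta_Y H22_char_gen
      by (cases p; cases "fst p"; cases "snd p"; simp add: Y_val_def d)
  qed
qed

end

theorem proposition2p13:
  fixes i w w' :: "'k::field"
    and D :: "('b, 'k) qha"
    and X Y :: "'b \<Rightarrow>\<^sub>0 'k"
  assumes char_not_2: "CHAR('k) \<noteq> 2"
    and primitive_root: "i ^ 4 = 1" "\<And>m. 0 < m \<Longrightarrow> m < 4 \<Longrightarrow> i ^ m \<noteq> 1"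
    and double: "is_DH2 D X Y"
    and omega: "(w, w') = (1 + i, 1 - i) \<or> (w, w') = (1 - i, 1 + i)"
  shows
    "alg_invertible H22 (U_elt w') \<and>
     is_twist H22 (F_elt w) \<and>
     - unt H22 + scale w (p_minus H22 gen_x) + scale w' (p_minus H22 gen_y)
       = scale (- (1/2)) (scale w gen_x + scale w' gen_y) \<and>
     (let T = change_antip (twist H22 (F_elt w)) (U_elt w');
          given = (\<lambda>\<zeta>. alg_hom D T \<zeta> \<and>
            \<zeta> X = gen_x \<cdot>\<^bsub>H22\<^esub> gen_y \<and>
            \<zeta> Y = - unt H22 + scale w (p_minus H22 gen_x) + scale w' (p_minus H22 gen_y))
      in (\<exists>!\<zeta>. given \<zeta>) \<and> (\<forall>\<zeta>. given \<zeta> \<longrightarrow> quasi_hopf_iso D T \<zeta>))"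
proof -
  have "(i\<^sup>2 - 1) * (i\<^sup>2 + 1) = 0"
    using primitive_root(1) by (simp add: algebra_simps flip: power_add)
  then have i2: "i\<^sup>2 = -1"
    using primitive_root(2)[of 2] by (simp add: eq_neg_iff_add_eq_0)
  have two: "(2 :: 'k) \<noteq> 0"
  proof
    assume "(2 :: 'k) = 0"
    then have "(1 :: 'k) = -1" by (simp add: eq_neg_iff_add_eq_0)
    then show False using i2 primitive_root(2)[of 2] by simp
  qed
  \<comment> \<open>\<open>d\<close> is \<open>- i\<close> or \<open>i\<close>, which treats both
    sign choices at once.\<close>
  define d where "d = 1 - w"
  have d: "d * d = -1" "w = 1 - d" "w' = 1 + d"
    using omega i2 by (auto simp: d_def power2_eq_square)
  note hyps = two d
  let ?given = "\<lambda>\<zeta>. alg_hom D (twisted_H22 w w') \<zeta> \<and> \<zeta> X = gen_x \<cdot>\<^bsub>H22\<^esub> gen_y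
      \<and> \<zeta> Y = scale (- (1/2)) (scale w gen_x + scale w' gen_y)"
  have "DH2_presented D X Y"
    using double by (simp add: is_DH2_def Let_def)
  then have "\<zeta> = \<zeta>'" if "?given \<zeta>" "?given \<zeta>'" for \<zeta> \<zeta>'
    by (rule DH2_hom_unique[where B = "twisted_H22 w w'"]) (use that in simp_all)
  then have "\<exists>!\<zeta>. ?given \<zeta>"
    using zeta_exists[OF hyps double] by blast
  moreover have "quasi_hopf_iso D (twisted_H22 w w') \<zeta>" if "?given \<zeta>" for \<zeta>
    using quasi_hopf_iso_zeta[OF hyps double] that by blast
  ultimately show ?thesis
    unfolding Let_def zeta_Y[OF hyps] twisted_H22_def[symmetric]
    using invertible_U[OF hyps] twist_F[OF hyps] by blast
qed

end
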